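(* Let $n\ge 1$ and let $D$ be a diagram in $TL_{n+1}$. Let $\hat D \in TL_{n,n+2}$ be the diagram obtained by folding down the top right end point of $D$. Let $I$ be the set of positions of innermost caps in $\hat D$, and for $i \in I$ let $D_i \in TL_n$ be the diagram obtained from $\hat D$ by removing the innermost cap at position $i$. Then $$\operatorname{coeff}_{\in f^{(n+1)}}(D) = \sum_{i\in I} \frac{[i]}{[n+1]}\operatorname{coeff}_{\in f^{(n)}}(D_i).$$
   Context: Quantum integers: $[n] = \frac{q^n-q^{-n}}{q-q^{-1}}$, with $q$ a formal parameter. Temperley-Lieb algebra: an $n$ strand Temperley-Lieb diagram is an isotopy class of planar diagrams in a rectangle with $n$ marked points on the upper edge and $n$ on the lower edge (each numbered $1,\dots,n$ from left to right), consisting of non-intersecting arcs joining these $2n$ points in pairs. An arc joining two lower points is a cap. $TL_n$ is the algebra over $\mathbb{C}(q)$ with basis the $n$ strand diagrams, and product given by stacking, each closed loop being removed and replaced by a factor $-[2]$. $e_i$ ($1\le i\le n-1$) is the diagram with a cup joining upper points $i,i+1$, a cap joining lower points $i,i+1$, and all other strands vertical. More generally, $TL_{n,m}$ is the $\mathbb{C}(q)$-vector space spanned by such diagrams with $n$ points on the upper edge and $m$ points on the lower edge. Jones-Wenzl idempotent: $f^{(n)} \in TL_n$ is the unique element with $f^{(n)}\neq 0$, $f^{(n)}f^{(n)}=f^{(n)}$, and $e_i f^{(n)} = f^{(n)} e_i = 0$ for all $i\in\{1,\dots,n-1\}$. For a diagram $D$, $\operatorname{coeff}_{\in f^{(n)}}(D)$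 is the coefficient of $D$ when $f^{(n)}$ is expanded in the diagram basis of $TL_n$. Folding down: for a diagram $D\in TL_{n+1}$, $\hat D$ has the same arcs as $D$, but the upper point number $n+1$ of $D$ is moved (around the right side) to become the rightmost lower point, number $n+2$; so $\hat D$ has $n$ upper points and $n+2$ lower points. Innermost caps: a cap is innermost if there are no caps nested inside it, i.e. it joins adjacent lower points $i$ and $i+1$; its position is then $i$. Removing it means deleting the arc and its two end points and renumbering the remaining lower points from left to right. *)

theory Defs
  imports
    "HOL-Computational_Algebra.Computational_Algebra"
    "HOL-Library.Poly_Mapping"
    "HOL-Library.Disjoint_Sets"
begin

section \<open>Quantum integers\<close>

text \<open>The field \<open>\<complex>(q)\<close> is the fraction field of \<open>\<complex>[q]\<close>.\<close>

type_synonym ratfun = "complex poly fract"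

definition q_param :: ratfun where
  "q_param = to_fract [:0, 1:]"

definition qint :: "nat \<Rightarrow> ratfun" where
  "qint n = (q_param ^ n - inverse q_param ^ n) / (q_param - inverse q_param)"


section \<open>Temperley--Lieb diagrams\<close>

text \<open>
  An isotopy class of planar diagrams without closed loops is determined by which marked points
  are joined, so a diagram is represented by its set of arcs, an arc being the set of its two end
  points.  Marked points are numbered from 1, left to right.
\<close>

datatype tl_point = Upper nat | Lower nat

type_synonym diagram = "tl_point set set"

definition tl_points :: "nat \<Rightarrow> nat \<Rightarrow> tl_point set" where
  "tl_points n m = Upper ` {1..n} \<union> Lower ` {1..m}"

text \<open>
  The order in which the marked points are met when the boundary of the rectangle is traversed
  clockwise from its lower right corner: lower points from right to left, then upper points from
  left to right.
\<close>

fun boundary_pos :: "tl_point \<Rightarrow> int" where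
  "boundary_pos (Upper i) = int i"
| "boundary_pos (Lower i) = - int i"

text \<open>Two arcs in a disc can be drawn disjointly iff their end points do not interleave.\<close>

definition noncrossing :: "diagram \<Rightarrow> bool" where
  "noncrossing D \<longleftrightarrow>
     (\<nexists>a b c d. {a, b} \<in> D \<and> {c, d} \<in> D \<and>
        boundary_pos a < boundary_pos c \<and> boundary_pos c < boundary_pos b \<and>
        boundary_pos b < boundary_pos d)"

definition tl_diagrams :: "nat \<Rightarrow> nat \<Rightarrow> diagram set" where
  "tl_diagrams n m =
     {D. partition_on (tl_points n m) D \<and> (\<forall>a\<in>D. card a = 2) \<and> noncrossing D}"


section \<open>Stacking\<close>

text \<open>
  Stacking \<open>A\<close> on top of \<open>B\<close> identifies the lower points of \<open>A\<close> with the upper points of \<open>B\<close>;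
  these become the \<open>Middle\<close> points.
\<close>

datatype stack_point = Top nat | Middle nat | Bottom nat

fun as_upper_layer :: "tl_point \<Rightarrow> stack_point" where
  "as_upper_layer (Upper i) = Top i"
| "as_upper_layer (Lower i) = Middle i"

fun as_lower_layer :: "tl_point \<Rightarrow> stack_point" where
  "as_lower_layer (Upper i) = Middle i"
| "as_lower_layer (Lower i) = Bottom i"

definition glue :: "diagram \<Rightarrow> diagram \<Rightarrow> stack_point set set" where
  "glue A B = (\<lambda>a. as_upper_layer ` a) ` A \<union> (\<lambda>a. as_lower_layer ` a) ` B"

definition stack_components :: "diagram \<Rightarrow> diagram \<Rightarrow> stack_point set set" where
  "stack_components A B = \<Union> (glue A B) // {(x, y). {x, y} \<in> glue A B}\<^sup>*"

definition outer_points :: "stack_point set \<Rightarrow> tl_point set" where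
  "outer_points C = Upper ` {i. Top i \<in> C} \<union> Lower ` {i. Bottom i \<in> C}"

text \<open>
  A connected component of the stacked picture is either an arc joining two outer points or a
  closed loop, which has no outer points.
\<close>

definition stack :: "diagram \<Rightarrow> diagram \<Rightarrow> diagram" where
  "stack A B = outer_points ` stack_components A B - {{}}"

definition loops :: "diagram \<Rightarrow> diagram \<Rightarrow> nat" where
  "loops A B = card {C \<in> stack_components A B. outer_points C = {}}"


section \<open>The Temperley--Lieb algebra and Jones--Wenzl idempotents\<close>

type_synonym tl_element = "diagram \<Rightarrow>\<^sub>0 ratfun"

definition TL :: "nat \<Rightarrow> nat \<Rightarrow> tl_element set" where
  "TL n m = {x. Poly_Mapping.keys x \<subseteq> tl_diagrams n m}"

definition tl_mult :: "tl_element \<Rightarrow> tl_element \<Rightarrow> tl_element" (infixl "\<circledast>" 70) where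
  "x \<circledast> y = (\<Sum>A\<in>Poly_Mapping.keys x. \<Sum>B\<in>Poly_Mapping.keys y.
     Poly_Mapping.single (stack A B)
       (Poly_Mapping.lookup x A * Poly_Mapping.lookup y B * (- qint 2) ^ loops A B))"

definition tl_gen_diagram :: "nat \<Rightarrow> nat \<Rightarrow> diagram" where
  "tl_gen_diagram n i =
     {{Upper i, Upper (i + 1)}, {Lower i, Lower (i + 1)}} \<union>
     (\<lambda>j. {Upper j, Lower j}) ` ({1..n} - {i, i + 1})"

definition tl_gen :: "nat \<Rightarrow> nat \<Rightarrow> tl_element" where
  "tl_gen n i = Poly_Mapping.single (tl_gen_diagram n i) 1"

definition jones_wenzl :: "nat \<Rightarrow> tl_element" where
  "jones_wenzl n = (THE f. f \<in> TL n n \<and> f \<noteq> 0 \<and> f \<circledast> f = f \<and>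
     (\<forall>i\<in>{1..<n}. tl_gen n i \<circledast> f = 0 \<and> f \<circledast> tl_gen n i = 0))"

definition jw_coeff :: "nat \<Rightarrow> diagram \<Rightarrow> ratfun" where
  "jw_coeff n D = Poly_Mapping.lookup (jones_wenzl n) D"


section \<open>Folding and innermost caps\<close>

text \<open>For \<open>D\<close> with \<open>n + 1\<close> upper and \<open>n + 1\<close> lower points.\<close>

definition fold_down :: "nat \<Rightarrow> diagram \<Rightarrow> diagram" where
  "fold_down n D = (\<lambda>a. (\<lambda>p. if p = Upper (n + 1) then Lower (n + 2) else p) ` a) ` D"

definition innermost_cap_positions :: "diagram \<Rightarrow> nat set" where
  "innermost_cap_positions D = {i. {Lower i, Lower (i + 1)} \<in> D}"

fun renumber :: "nat \<Rightarrow> tl_point \<Rightarrow> tl_point" where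
  "renumber i (Upper j) = Upper j"
| "renumber i (Lower j) = Lower (if j > i + 1 then j - 2 else j)"

definition remove_cap :: "nat \<Rightarrow> diagram \<Rightarrow> diagram" where
  "remove_cap i D = (\<lambda>a. renumber i ` a) ` (D - {{Lower i, Lower (i + 1)}})"

text \<open>
  In a diagram, the caps joining adjacent lower points are exactly those with no cap nested
  inside.
\<close>

lemma innermost_cap_iff:
  assumes D: "D \<in> tl_diagrams n m" and cap: "{Lower a, Lower b} \<in> D" and "a < b"
  shows "(\<nexists>c d. {Lower c, Lower d} \<in> D \<and> a < c \<and> c < d \<and> d < b) \<longleftrightarrow> b = a + 1"
proof
  assume no: "\<nexists>c d. {Lower c, Lower d} \<in> D \<and> a < c \<and> c < d \<and> d < b"
  show "b = a + 1"
  proof (rule ccontr)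
    assume "b \<noteq> a + 1"
    with \<open>a < b\<close> have ab: "a + 1 < b" by simp
    have part: "partition_on (tl_points n m) D" and card2: "\<forall>x\<in>D. card x = 2"
      and nc: "noncrossing D"
      using D by (auto simp: tl_diagrams_def)
    have U: "\<Union> D = tl_points n m" using part by (simp add: partition_on_def)
    have "Lower b \<in> tl_points n m" "Lower a \<in> tl_points n m" using cap U by blast+
    then have "a \<ge> 1" by (auto simp: tl_points_def)
    have "Lower b \<in> tl_points n m" using cap U by blast
    then have "Lower (a + 1) \<in> \<Union> D" using ab U by (auto simp: tl_points_def)
    then obtain x where x: "x \<in> D" "Lower (a + 1) \<in> x" by blast
    with card2 obtain p where p: "x = {Lower (a + 1), p}" "p \<noteq> Lower (a + 1)"
      by (metis card_2_iff insertE insert_commute singletonD)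
    have ne: "x \<noteq> {Lower a, Lower b}" using x(2) ab by auto
    then have disj: "x \<inter> {Lower a, Lower b} = {}"
      using part cap x(1) by (auto simp: partition_on_def disjoint_def)
    have flip: "{u, v} \<in> D \<longleftrightarrow> {v, u} \<in> D" for u v by (simp add: insert_commute)
    have cross: False if "{u, v} \<in> D" "{w, z} \<in> D" "boundary_pos u < boundary_pos w"
      "boundary_pos w < boundary_pos v" "boundary_pos v < boundary_pos z" for u v w z
      using nc that unfolding noncrossing_def by blast
    have xD: "{Lower (a + 1), p} \<in> D" using x p by simp
    show False
    proof (cases p)
      case (Upper i)
      show False
        using cross[of "Lower b" "Lower a" "Lower (a + 1)" p] cap xD flip Upper ab \<open>a \<ge> 1\<close>
        by (simp add: insert_commute)
    next
      case (Lower d)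
      have "d \<noteq> a" "d \<noteq> b" "d \<noteq> a + 1" using disj p Lower by auto
      then consider "d < a" | "a + 1 < d" "d < b" | "b < d" by linarith
      then show False
      proof cases
        case 1
        then show False
          using cross[of "Lower b" "Lower a" "Lower (a + 1)" p] cap xD flip Lower ab
          by (simp add: insert_commute)
      next
        case 2
        then show False using no xD Lower by auto
      next
        case 3
        then show False
          using cross[of p "Lower (a + 1)" "Lower b" "Lower a"] cap xD flip Lower ab
          by (simp add: insert_commute)
      qed
    qed
  qed
qed auto

end

theory Submission
  imports Defs
begin

text \<open>
  A nonidentity diagram joins two adjacent upper points, so an element that is annihilated on the
  right by all generators is annihilated by every diagram but the identity.  If its identity
  coefficient is 1, comparing it with its upside-down reflection shows that it is the Jones--Wenzl
  idempotent.  It remains to see that the element \<open>g\<close> of \<open>TL\<^bsub>n+1\<^esub>\<close> given by the right-hand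
  side of the claimed formula is annihilated by the generators.  Folded down, \<open>g\<close> is the sum over
  \<open>i\<close> of \<open>[i]/[n+1]\<close> times \<open>f\<^sup>(\<^sup>n\<^sup>)\<close> with a cap inserted at position \<open>i\<close>.  Multiplying by the generator \<open>e\<^sub>j\<close>
  kills the terms with \<open>\<bar>i - j\<bar> > 1\<close>, because there a generator acts on \<open>f\<^sup>(\<^sup>n\<^sup>)\<close> itself, and turns the
  three remaining ones into multiples of the same element, with total factor
  \<open>[j - 1] - [2][j] + [j + 1] = 0\<close>.
\<close>

section \<open>Quantum integers and linear extension\<close>

text \<open>Stacking is defined through connected components, which makes associativity of the
  product laborious. It is avoided: if \<open>D\<close> has a cup at \<open>j\<close>, then stacking
  \<open>A\<close> first on \<open>e_j\<close> and the result on \<open>D\<close> gives the same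
  diagram as stacking \<open>A\<close> on \<open>D\<close>, with exactly one more closed loop in
  total. Hence \<open>x e_j = 0\<close> gives \<open>- [2] (x D) = 0\<close>, and \<open>[2]\<close>
  is invertible.

  The one-sided criterion matters because the inserted caps sit on the lower edge, where right
  multiplication acts; left multiplication by the last generator would involve the folded strand.

  The coefficients are forced. A sequence with \<open>c_(j-1) - [2] c_j + c_(j+1) = 0\<close> and
  \<open>c_0 = 0\<close> is a multiple of \<open>[i]\<close>, and its value at \<open>n + 1\<close>
  must be 1 because the folded identity has its only cap there; this gives
  \<open>[i] / [n + 1]\<close>. Since the idempotent is given by a definite description, its
  existence for every \<open>n\<close> has to come out of the same induction.\<close>

lemma to_fract_power: "to_fract (x ^ k) = to_fract x ^ k"
  by (induction k) simp_all

text \<open>Powers of the indeterminate have distinct degrees, so \<open>q_param\<close> is not a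
  root of unity. The invertibility of the quantum integers \<open>[k]\<close> with
  \<open>k > 0\<close> rests on this.\<close>

lemma q_param_power_eq_1_iff: "q_param ^ k = 1 \<longleftrightarrow> k = 0"
proof
  assume "q_param ^ k = 1"
  then have "to_fract ([:0, 1:] ^ k) = to_fract (1 :: complex poly)"
    by (simp add: q_param_def to_fract_power)
  then have "[:0, 1:] ^ k = (1 :: complex poly)"
    by (simp only: to_fract_eq_iff)
  then have "degree ([:0, 1:] ^ k :: complex poly) = 0"
    by simp
  then show "k = 0"
    by (simp add: degree_power_eq)
qed simp

lemma q_param_nonzero: "q_param \<noteq> 0"
  by (simp add: q_param_def)

lemma qint_numerator_nonzero:
  assumes "k > 0"
  shows "q_param ^ k - inverse q_param ^ k \<noteq> 0"
proof
  assume "q_param ^ k - inverse q_param ^ k = 0"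
  then have "q_param ^ k * q_param ^ k = 1"
    using q_param_nonzero by (simp add: field_simps)
  then have "q_param ^ (k + k) = 1"
    by (simp add: power_add)
  then show False
    using assms q_param_power_eq_1_iff by simp
qed

lemma qint_denominator_nonzero: "q_param - inverse q_param \<noteq> 0"
  using qint_numerator_nonzero[of 1] by simp

lemma qint_nonzero: "k > 0 \<Longrightarrow> qint k \<noteq> 0"
  using qint_numerator_nonzero qint_denominator_nonzero by (simp add: qint_def)

lemma qint_0: "qint 0 = 0" and qint_1: "qint (Suc 0) = 1"
  using qint_denominator_nonzero by (simp_all add: qint_def)

lemma qint_2_mult: "qint 2 * qint (Suc k) = qint k + qint (Suc (Suc k))"
proof -
  define d where "d = q_param - inverse q_param"
  have d: "d \<noteq> 0"
    using qint_denominator_nonzero by (simp add: d_def)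
  have qq: "q_param * inverse q_param = 1"
    using q_param_nonzero by simp
  \<comment> \<open>This is the claim with denominators cleared, for \<open>a = q\<close> and
    \<open>b\<close> its inverse. The mixed products in \<open>(a + b) (a^(k+1) - b^(k+1))\<close>
    lose one factor each because \<open>a b = 1\<close>.\<close>
  have "(a ^ 2 - b ^ 2) * (a ^ Suc k - b ^ Suc k)
      = (a - b) * ((a ^ k - b ^ k) + (a ^ Suc (Suc k) - b ^ Suc (Suc k)))"
    if "a * b = 1" for a b :: ratfun
  proof -
    have *: "a * (b * x) = x" "b * (a * x) = x" for x
      using that by (simp_all add: mult.assoc [symmetric] mult.commute[of b a])
    show ?thesis
      by (simp add: algebra_simps power2_eq_square *)
  qed
  from this[OF qq] show ?thesis
    using d unfolding qint_def d_def [symmetric] by (simp add: field_simps power2_eq_square)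
qed

text \<open>The linear extension of a map that sends a basis diagram to a scalar times a diagram.
  Right multiplication by a diagram, where \<open>k\<close> records the loop factor, reflection and
  cap insertion all have this form.\<close>

definition tl_lin :: "(diagram \<Rightarrow> diagram) \<Rightarrow> (diagram \<Rightarrow> ratfun) \<Rightarrow> tl_element \<Rightarrow> tl_element" where
  "tl_lin h k x = (\<Sum>A\<in>Poly_Mapping.keys x.
     Poly_Mapping.single (h A) (Poly_Mapping.lookup x A * k A))"

lemma tl_lin_0 [simp]: "tl_lin h k 0 = 0"
  by (simp add: tl_lin_def)

lemma tl_lin_single: "tl_lin h k (Poly_Mapping.single A c) = Poly_Mapping.single (h A) (c * k A)"
  by (simp add: tl_lin_def)

lemma tl_lin_add: "tl_lin h k (x + y) = tl_lin h k x + tl_lin h k y"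
  unfolding tl_lin_def
  by (rule setsum_keys_plus_distrib[where f = "\<lambda>A c. Poly_Mapping.single (h A) (c * k A)"])
    (simp_all add: algebra_simps single_add)

lemma tl_lin_sum: "tl_lin h k (\<Sum>i\<in>S. x i) = (\<Sum>i\<in>S. tl_lin h k (x i))"
  by (induction S rule: infinite_finite_induct) (simp_all add: tl_lin_add)

text \<open>The inner map may merge diagrams or cancel them, but the outer map is additive and can
  be applied summand by summand. Compositions of linear maps are thereby compared on basis
  diagrams.\<close>

lemma tl_lin_tl_lin: "tl_lin h k (tl_lin h' k' x) = tl_lin (\<lambda>A. h (h' A)) (\<lambda>A. k' A * k (h' A)) x"
  unfolding tl_lin_def[of h' k'] tl_lin_sum tl_lin_single
  by (simp add: tl_lin_def mult.assoc)

lemma tl_lin_cong: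
  assumes "\<And>A. A \<in> Poly_Mapping.keys x \<Longrightarrow> h A = h' A"
    and "\<And>A. A \<in> Poly_Mapping.keys x \<Longrightarrow> k A = k' A"
  shows "tl_lin h k x = tl_lin h' k' x"
  using assms by (simp add: tl_lin_def)

lemma lookup_tl_lin:
  "Poly_Mapping.lookup (tl_lin h k x) D =
     (\<Sum>A\<in>Poly_Mapping.keys x. if h A = D then Poly_Mapping.lookup x A * k A else 0)"
  by (simp add: tl_lin_def lookup_sum lookup_single when_def)

lemma lookup_tl_lin_scale:
  "Poly_Mapping.lookup (tl_lin h (\<lambda>A. c * k A) x) D = c * Poly_Mapping.lookup (tl_lin h k x) D"
  unfolding lookup_tl_lin sum_distrib_left by (rule sum.cong) simp_all

text \<open>By injectivity only \<open>A\<close> itself can contribute to the coefficient at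
  \<open>h A\<close>. Including \<open>A\<close> in the domain of injectivity covers the case that
  \<open>A\<close> does not occur in \<open>x\<close>, where both sides vanish.\<close>

lemma lookup_tl_lin_inj:
  assumes "inj_on h (insert A (Poly_Mapping.keys x))"
  shows "Poly_Mapping.lookup (tl_lin h k x) (h A) = Poly_Mapping.lookup x A * k A"
proof -
  have "Poly_Mapping.lookup (tl_lin h k x) (h A) =
      (\<Sum>B\<in>Poly_Mapping.keys x. if B = A then Poly_Mapping.lookup x A * k A else 0)"
    unfolding lookup_tl_lin using assms by (intro sum.cong) (auto dest: inj_onD)
  then show ?thesis
    by (simp add: in_keys_iff)
qed

lemma keys_tl_lin: "Poly_Mapping.keys (tl_lin h k x) \<subseteq> h ` Poly_Mapping.keys x"
proof
  fix D
  assume "D \<in> Poly_Mapping.keys (tl_lin h k x)"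
  then have "(\<Sum>A\<in>Poly_Mapping.keys x. if h A = D then Poly_Mapping.lookup x A * k A else 0) \<noteq> 0"
    by (simp add: in_keys_iff lookup_tl_lin)
  then show "D \<in> h ` Poly_Mapping.keys x"
    by (auto elim!: sum.not_neutral_contains_not_neutral split: if_splits)
qed

lemma tl_mult_single: "x \<circledast> Poly_Mapping.single B 1 = tl_lin (\<lambda>A. stack A B) (\<lambda>A. (- qint 2) ^ loops A B) x"
  by (simp add: tl_mult_def tl_lin_def)

lemma lookup_tl_mult:
  "Poly_Mapping.lookup (x \<circledast> y) D =
     (\<Sum>B\<in>Poly_Mapping.keys y.
        Poly_Mapping.lookup y B * Poly_Mapping.lookup (x \<circledast> Poly_Mapping.single B 1) D)"
  unfolding tl_mult_single lookup_tl_lin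
  by (simp add: tl_mult_def lookup_sum lookup_single when_def sum_distrib_left,
      subst sum.swap, intro sum.cong refl) simp

section \<open>Stacking\<close>

text \<open>A way to certify a guessed list of connected components: no edge leaves a block, and
  every block is reachable from one hub. By symmetry of the edges, reachability from a hub connects
  any two points of the block.\<close>

lemma quotient_rtrancl_eqI:
  assumes P: "partition_on V P" and "sym R"
    and hub: "\<And>C. C \<in> P \<Longrightarrow> \<exists>h. \<forall>x\<in>C. (h, x) \<in> R\<^sup>*"
    and edge: "\<And>x y. (x, y) \<in> R \<Longrightarrow> \<exists>C\<in>P. x \<in> C \<and> y \<in> C"
  shows "V // R\<^sup>* = P"
proof -
  have cls: "R\<^sup>* `` {x} = C" if "C \<in> P" "x \<in> C" for C x
  proof
    show "R\<^sup>* `` {x} \<subseteq> C"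
    proof
      fix y
      assume "y \<in> R\<^sup>* `` {x}"
      then have "(x, y) \<in> R\<^sup>*" by simp
      then show "y \<in> C"
      proof induction
        case base
        show ?case by (fact that(2))
      next
        case (step y z)
        then obtain C' where "C' \<in> P" "y \<in> C'" "z \<in> C'"
          using edge by blast
        then show ?case
          using step.IH that(1) partition_onD2[OF P] by (auto simp: disjoint_def)
      qed
    qed
    obtain h where h: "\<forall>x\<in>C. (h, x) \<in> R\<^sup>*"
      using hub \<open>C \<in> P\<close> by blast
    have "sym (R\<^sup>*)"
      using \<open>sym R\<close> by (rule sym_rtrancl)
    with h that show "C \<subseteq> R\<^sup>* `` {x}"
      by (auto dest: symD intro: rtrancl_trans)
  qed
  have "V = \<Union> P" "{} \<notin> P"
    using P by (auto simp: partition_on_def)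
  show ?thesis
  proof
    show "V // R\<^sup>* \<subseteq> P"
      using cls \<open>V = \<Union> P\<close> by (auto simp: quotient_def)
    show "P \<subseteq> V // R\<^sup>*"
    proof
      fix C
      assume "C \<in> P"
      with \<open>{} \<notin> P\<close> obtain x where "x \<in> C" by (metis ex_in_conv)
      then have "R\<^sup>* `` {x} = C" "x \<in> V"
        using cls \<open>C \<in> P\<close> \<open>V = \<Union> P\<close> by auto
      then show "C \<in> V // R\<^sup>*"
        by (metis quotientI)
    qed
  qed
qed

section \<open>Points and arcs of glued pictures\<close>

abbreviation glue_rel :: "diagram \<Rightarrow> diagram \<Rightarrow> stack_point rel" where
  "glue_rel A B \<equiv> {(x, y). {x, y} \<in> glue A B}"

lemma sym_glue_rel: "sym (glue_rel A B)"
  by (auto simp: sym_def insert_commute)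

lemma as_upper_layer_image_iff:
  "Top i \<in> as_upper_layer ` a \<longleftrightarrow> Upper i \<in> a"
  "Middle i \<in> as_upper_layer ` a \<longleftrightarrow> Lower i \<in> a"
  "Bottom i \<notin> as_upper_layer ` a"
proof -
  have *: "as_upper_layer p = Top i \<longleftrightarrow> p = Upper i" "as_upper_layer p = Middle i \<longleftrightarrow> p = Lower i"
    "as_upper_layer p \<noteq> Bottom i" for p
    by (cases p; auto)+
  show "Top i \<in> as_upper_layer ` a \<longleftrightarrow> Upper i \<in> a"
    using *(1) by (metis image_iff)
  show "Middle i \<in> as_upper_layer ` a \<longleftrightarrow> Lower i \<in> a"
    using *(2) by (metis image_iff)
  show "Bottom i \<notin> as_upper_layer ` a"
    using *(3) by (metis image_iff)
qed

lemma as_lower_layer_image_iff: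
  "Middle i \<in> as_lower_layer ` a \<longleftrightarrow> Upper i \<in> a"
  "Bottom i \<in> as_lower_layer ` a \<longleftrightarrow> Lower i \<in> a"
  "Top i \<notin> as_lower_layer ` a"
proof -
  have *: "as_lower_layer p = Middle i \<longleftrightarrow> p = Upper i" "as_lower_layer p = Bottom i \<longleftrightarrow> p = Lower i"
    "as_lower_layer p \<noteq> Top i" for p
    by (cases p; auto)+
  show "Middle i \<in> as_lower_layer ` a \<longleftrightarrow> Upper i \<in> a"
    using *(1) by (metis image_iff)
  show "Bottom i \<in> as_lower_layer ` a \<longleftrightarrow> Lower i \<in> a"
    using *(2) by (metis image_iff)
  show "Top i \<notin> as_lower_layer ` a"
    using *(3) by (metis image_iff)
qed

lemma stack_point_setI:
  assumes "\<And>i. Top i \<in> X \<longleftrightarrow> Top i \<in> Y" "\<And>i. Middle i \<in> X \<longleftrightarrow> Middle i \<in> Y"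
    "\<And>i. Bottom i \<in> X \<longleftrightarrow> Bottom i \<in> Y"
  shows "X = Y"
  using assms by (metis set_eqI stack_point.exhaust)

lemma tl_point_setI:
  assumes "\<And>i. Upper i \<in> X \<longleftrightarrow> Upper i \<in> Y" "\<And>i. Lower i \<in> X \<longleftrightarrow> Lower i \<in> Y"
  shows "X = Y"
  using assms by (metis set_eqI tl_point.exhaust)

lemma Union_glue: "\<Union> (glue A B) = as_upper_layer ` \<Union> A \<union> as_lower_layer ` \<Union> B"
  by (auto simp: glue_def)

lemma outer_points_iff [simp]:
  "Upper i \<in> outer_points C \<longleftrightarrow> Top i \<in> C" "Lower i \<in> outer_points C \<longleftrightarrow> Bottom i \<in> C"
  by (auto simp: outer_points_def)

lemma glue_upperI: "{p, q} \<in> A \<Longrightarrow> {as_upper_layer p, as_upper_layer q} \<in> glue A B"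
  unfolding glue_def by (rule UnI1, rule image_eqI[where x = "{p, q}"]) simp_all

lemma glue_lowerI: "{p, q} \<in> B \<Longrightarrow> {as_lower_layer p, as_lower_layer q} \<in> glue A B"
  unfolding glue_def by (rule UnI2, rule image_eqI[where x = "{p, q}"]) simp_all

lemma glue_cases:
  assumes "a \<in> glue A B"
  obtains b where "b \<in> A" "a = as_upper_layer ` b" | b where "b \<in> B" "a = as_lower_layer ` b"
  using assms unfolding glue_def by blast

lemma tl_points_iff [simp]:
  "Upper i \<in> tl_points n m \<longleftrightarrow> 1 \<le> i \<and> i \<le> n" "Lower i \<in> tl_points n m \<longleftrightarrow> 1 \<le> i \<and> i \<le> m"
  by (auto simp: tl_points_def)

lemma tl_diagramsD:
  assumes "A \<in> tl_diagrams n m"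
  shows "\<Union> A = tl_points n m" "{} \<notin> A" "\<And>a. a \<in> A \<Longrightarrow> card a = 2" "noncrossing A"
    "\<And>a b x. a \<in> A \<Longrightarrow> b \<in> A \<Longrightarrow> x \<in> a \<Longrightarrow> x \<in> b \<Longrightarrow> a = b" "partition_on (tl_points n m) A"
proof -
  have P: "partition_on (tl_points n m) A" "\<forall>a\<in>A. card a = 2" "noncrossing A"
    using assms by (auto simp: tl_diagrams_def)
  then show "\<Union> A = tl_points n m" "{} \<notin> A" "\<And>a. a \<in> A \<Longrightarrow> card a = 2" "noncrossing A"
    "partition_on (tl_points n m) A"
    by (auto simp: partition_on_def)
  show "a = b" if "a \<in> A" "b \<in> A" "x \<in> a" "x \<in> b" for a b x
    using that partition_onD2[OF P(1)] by (meson disjointD disjoint_iff)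
qed

lemma card_2_other:
  assumes "card a = 2" "x \<in> a"
  obtains y where "a = {x, y}" "x \<noteq> y"
  using assms by (metis card_2_iff insertE insert_commute singletonD)

lemma tl_diagrams_arc:
  assumes "A \<in> tl_diagrams n m" "x \<in> tl_points n m"
  obtains y where "{x, y} \<in> A" "x \<noteq> y"
proof -
  from assms obtain a where "a \<in> A" "x \<in> a"
    using tl_diagramsD(1) by blast
  then show thesis
    using that card_2_other[of a x] tl_diagramsD(3)[OF assms(1)] by metis
qed

section \<open>The identity diagram as a right unit\<close>

definition tl_id_diagram :: "nat \<Rightarrow> diagram" where
  "tl_id_diagram n = (\<lambda>j. {Upper j, Lower j}) ` {1..n}"

text \<open>Vertical strands only prolong the arcs that end at them, so components correspond to
  arcs of \<open>A\<close>; \<open>C\<close> adds to an arc the bottom ends of the strands attached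
  to it.\<close>

lemma stack_id_right_components:
  assumes A: "A \<in> tl_diagrams n n"
  defines "C \<equiv> \<lambda>a. as_upper_layer ` a \<union> Bottom ` {i. Lower i \<in> a}"
  shows "stack_components A (tl_id_diagram n) = C ` A"
  unfolding stack_components_def
proof (rule quotient_rtrancl_eqI)
  note AD = tl_diagramsD[OF A]
  have mem: "Top i \<in> C a \<longleftrightarrow> Upper i \<in> a" "Middle i \<in> C a \<longleftrightarrow> Lower i \<in> a"
    "Bottom i \<in> C a \<longleftrightarrow> Lower i \<in> a" for i a
    by (auto simp: C_def as_upper_layer_image_iff)
  have UI: "\<Union> (tl_id_diagram n) = tl_points n n"
    by (rule tl_point_setI) (auto simp: tl_id_diagram_def)
  show "partition_on (\<Union> (glue A (tl_id_diagram n))) (C ` A)"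
  proof (rule partition_onI)
    show "\<Union> (C ` A) = \<Union> (glue A (tl_id_diagram n))"
      unfolding Union_glue UI AD(1)[symmetric]
      by (rule stack_point_setI) (simp_all add: mem as_upper_layer_image_iff as_lower_layer_image_iff AD(1),
        simp_all add: AD(1) flip: Union_iff)
    show "{} \<notin> C ` A"
      using AD(2) by (auto simp: C_def)
    fix p q
    assume "p \<in> C ` A" "q \<in> C ` A" "p \<noteq> q"
    then obtain a b where ab: "a \<in> A" "b \<in> A" "p = C a" "q = C b" by blast
    show "disjnt p q"
      unfolding disjnt_iff
    proof (intro allI notI)
      fix x
      assume "x \<in> p \<and> x \<in> q"
      then have "a = b"
        using ab AD(5)[of a b] by (cases x) (auto simp: mem)
      then show False
        using ab \<open>p \<noteq> q\<close> by simp
    qed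
  qed
  show "sym (glue_rel A (tl_id_diagram n))"
    by (rule sym_glue_rel)
  show "\<exists>D\<in>C ` A. x \<in> D \<and> y \<in> D" if "(x, y) \<in> glue_rel A (tl_id_diagram n)" for x y
  proof -
    from that consider a where "a \<in> A" "{x, y} = as_upper_layer ` a"
      | j where "j \<in> {1..n}" "{x, y} = {Middle j, Bottom j}"
      by (auto simp: glue_def tl_id_diagram_def)
    then show ?thesis
    proof cases
      case 1
      then have "x \<in> as_upper_layer ` a" "y \<in> as_upper_layer ` a" by blast+
      with 1(1) show ?thesis by (auto simp: C_def)
    next
      case 2
      then have "Lower j \<in> \<Union> A" by (simp add: AD(1))
      with 2 show ?thesis by (auto simp: mem doubleton_eq_iff)
    qed
  qed
  fix D
  assume "D \<in> C ` A"
  then obtain a where a: "a \<in> A" "D = C a" by blast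
  then obtain p q where pq: "a = {p, q}"
    using AD(3) by (meson card_2_iff)
  let ?R = "glue_rel A (tl_id_diagram n)"
  have up: "(as_upper_layer p, as_upper_layer r) \<in> ?R\<^sup>*" if "r \<in> a" for r
    using that a(1) pq glue_upperI[of p q A "tl_id_diagram n"] by auto
  have "(as_upper_layer p, x) \<in> ?R\<^sup>*" if "x \<in> D" for x
  proof (cases "x \<in> as_upper_layer ` a")
    case True
    then show ?thesis using up by blast
  next
    case False
    with that a obtain i where i: "x = Bottom i" "Lower i \<in> a"
      by (auto simp: C_def)
    then have "i \<in> {1..n}"
      using AD(1) a(1) by (metis UnionI atLeastAtMost_iff tl_points_iff(2))
    then have "{Upper i, Lower i} \<in> tl_id_diagram n"
      by (auto simp: tl_id_diagram_def)
    then have "(Middle i, Bottom i) \<in> ?R"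
      using glue_lowerI by fastforce
    moreover have "(as_upper_layer p, Middle i) \<in> ?R\<^sup>*"
      using up[OF i(2)] by simp
    ultimately show ?thesis
      using i(1) by (meson rtrancl.rtrancl_into_rtrancl)
  qed
  then show "\<exists>h. \<forall>x\<in>D. (h, x) \<in> ?R\<^sup>*" by blast
qed

lemma stack_id_right:
  assumes "A \<in> tl_diagrams n n"
  shows "stack A (tl_id_diagram n) = A" "loops A (tl_id_diagram n) = 0"
proof -
  have outer: "outer_points (as_upper_layer ` a \<union> Bottom ` {i. Lower i \<in> a}) = a" for a
    by (rule tl_point_setI) (auto simp: as_upper_layer_image_iff)
  show "stack A (tl_id_diagram n) = A"
    using tl_diagramsD(2)[OF assms]
    by (simp add: stack_def stack_id_right_components[OF assms] image_image outer)
  have "{C \<in> stack_components A (tl_id_diagram n). outer_points C = {}} = {}"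
    using tl_diagramsD(2)[OF assms]
    by (auto simp: stack_id_right_components[OF assms] outer)
  then show "loops A (tl_id_diagram n) = 0"
    by (simp only: loops_def card.empty)
qed

section \<open>Capping off two adjacent strands\<close>

text \<open>The effect of \<open>e_j\<close> on the arcs above it: the arcs ending at
  \<open>x\<close> and \<open>y\<close> are fused into one, and a new cap joins \<open>x\<close> and
  \<open>y\<close>. If \<open>{x, y}\<close> was already an arc, the fused arc is a closed loop and
  leaves the empty set, which is discarded.\<close>

definition cap_off :: "'a \<Rightarrow> 'a \<Rightarrow> 'a set set \<Rightarrow> 'a set set" where
  "cap_off x y A = insert {x, y}
     ({a \<in> A. x \<notin> a \<and> y \<notin> a} \<union> ({\<Union> {a \<in> A. x \<in> a \<or> y \<in> a} - {x, y}} - {{}}))"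

text \<open>Capping off depends only on incidences, so it commutes with an injective relabelling of
  the points. This carries the action of a generator on a smaller diagram over to the larger
  one.\<close>

lemma cap_off_image:
  assumes "inj f"
  shows "cap_off (f x) (f y) ((`) f ` A) = (`) f ` cap_off x y A"
proof -
  have mem: "f z \<in> f ` a \<longleftrightarrow> z \<in> a" for z a
    using assms by (rule inj_image_mem_iff)
  have gen: "{b \<in> (`) f ` A. P b} = (`) f ` {a \<in> A. P (f ` a)}" for P
    by auto
  have *: "{b \<in> (`) f ` A. f x \<notin> b \<and> f y \<notin> b} = (`) f ` {a \<in> A. x \<notin> a \<and> y \<notin> a}"
    "{b \<in> (`) f ` A. f x \<in> b \<or> f y \<in> b} = (`) f ` {a \<in> A. x \<in> a \<or> y \<in> a}"
    by (simp_all only: gen mem)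
  have "\<Union> ((`) f ` {a \<in> A. x \<in> a \<or> y \<in> a}) - {f x, f y} = f ` (\<Union> {a \<in> A. x \<in> a \<or> y \<in> a} - {x, y})"
    using assms by (auto dest: injD)
  then show ?thesis
    unfolding cap_off_def * by (simp add: image_Un insert_Diff_if)
qed

lemma cap_off_insert:
  assumes "x \<notin> c" "y \<notin> c"
  shows "cap_off x y (insert c A) = insert c (cap_off x y A)"
proof -
  have "{a \<in> insert c A. x \<notin> a \<and> y \<notin> a} = insert c {a \<in> A. x \<notin> a \<and> y \<notin> a}"
    "{a \<in> insert c A. x \<in> a \<or> y \<in> a} = {a \<in> A. x \<in> a \<or> y \<in> a}"
    using assms by auto
  then show ?thesis
    unfolding cap_off_def by auto
qed

text \<open>The old arc closes up to a loop and the new cap takes its place.\<close>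

lemma cap_off_arc:
  assumes "\<And>a. a \<in> A \<Longrightarrow> x \<in> a \<or> y \<in> a \<Longrightarrow> a = {x, y}" and "{x, y} \<in> A"
  shows "cap_off x y A = A"
proof -
  have "{a \<in> A. x \<in> a \<or> y \<in> a} = {{x, y}}"
    using assms by blast
  then have "\<Union> {a \<in> A. x \<in> a \<or> y \<in> a} - {x, y} = {}"
    by simp
  then have "cap_off x y A = insert {x, y} {a \<in> A. x \<notin> a \<and> y \<notin> a}"
    unfolding cap_off_def by simp
  also have "\<dots> = A"
    using assms by blast
  finally show ?thesis .
qed

lemma cap_off_two_arcs:
  assumes "\<And>a. a \<in> A \<Longrightarrow> x \<in> a \<Longrightarrow> a = {x, p}" "{x, p} \<in> A"
    and "\<And>a. a \<in> A \<Longrightarrow> y \<in> a \<Longrightarrow> a = {y, p'}" "{y, p'} \<in> A"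
    and "p \<notin> {x, y}" "p' \<notin> {x, y}"
  shows "cap_off x y A = insert {x, y} (insert {p, p'} (A - {{x, p}, {y, p'}}))"
proof -
  have "{a \<in> A. x \<in> a \<or> y \<in> a} = {{x, p}, {y, p'}}"
    using assms(1-4) by blast
  then have "\<Union> {a \<in> A. x \<in> a \<or> y \<in> a} - {x, y} = {p, p'}"
    using assms(5,6) by auto
  moreover have "{a \<in> A. x \<notin> a \<and> y \<notin> a} = A - {{x, p}, {y, p'}}"
    using assms(1-4) by blast
  ultimately show ?thesis
    unfolding cap_off_def by auto
qed

text \<open>The cup of the generator fuses the one or two arcs of \<open>A\<close> that end at
  positions \<open>j\<close> and \<open>j + 1\<close> into the component \<open>m\<close>; its cap
  is a component of its own, and all other strands prolong arcs as in the identity diagram.\<close>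

lemma stack_gen_right_components:
  assumes A: "A \<in> tl_diagrams n n" and j: "1 \<le> j" "j < n"
  defines "C \<equiv> \<lambda>a. as_upper_layer ` a \<union> Bottom ` ({i. Lower i \<in> a} - {j, j + 1})"
    and "m \<equiv> \<Union> {a \<in> A. Lower j \<in> a \<or> Lower (j + 1) \<in> a}"
  shows "stack_components A (tl_gen_diagram n j) = insert {Bottom j, Bottom (j + 1)}
    (C ` insert m {a \<in> A. Lower j \<notin> a \<and> Lower (j + 1) \<notin> a})"
  unfolding stack_components_def
proof (rule quotient_rtrancl_eqI)
  note AD = tl_diagramsD[OF A]
  let ?G = "tl_gen_diagram n j"
  let ?R = "glue_rel A ?G"
  define A' where "A' = insert m {a \<in> A. Lower j \<notin> a \<and> Lower (j + 1) \<notin> a}"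
  have mem: "Top i \<in> C a \<longleftrightarrow> Upper i \<in> a" "Middle i \<in> C a \<longleftrightarrow> Lower i \<in> a"
    "Bottom i \<in> C a \<longleftrightarrow> Lower i \<in> a \<and> i \<noteq> j \<and> i \<noteq> j + 1" for i a
    by (auto simp: C_def as_upper_layer_image_iff)
  have UG: "\<Union> ?G = tl_points n n"
    using j by (intro tl_point_setI) (auto simp: tl_gen_diagram_def)
  have UA': "\<Union> A' = tl_points n n"
    unfolding AD(1)[symmetric] A'_def m_def by blast
  have sub_m: "a \<subseteq> m" if "a \<in> A" "Lower j \<in> a \<or> Lower (j + 1) \<in> a" for a
    using that by (auto simp: m_def)
  have A'_sup: "\<exists>b\<in>A'. a \<subseteq> b" if "a \<in> A" for a
    using that sub_m[of a] by (cases "Lower j \<in> a \<or> Lower (j + 1) \<in> a") (auto simp: A'_def)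
  have pts: "Lower j \<in> tl_points n n" "Lower (j + 1) \<in> tl_points n n"
    using j by simp_all
  have m: "Lower j \<in> m" "Lower (j + 1) \<in> m"
    using pts unfolding AD(1)[symmetric] m_def by blast+
  have A'_dis: "a = b" if "a \<in> A'" "b \<in> A'" "x \<in> a" "x \<in> b" for a b x
  proof -
    have out: "x \<notin> m" if "a \<in> A" "Lower j \<notin> a" "Lower (j + 1) \<notin> a" "x \<in> a" for a
    proof
      assume "x \<in> m"
      then obtain b where "b \<in> A" "Lower j \<in> b \<or> Lower (j + 1) \<in> b" "x \<in> b"
        by (auto simp: m_def)
      then show False
        using AD(5)[of a b x] that by simp
    qed
    have "c = m \<or> c \<in> A \<and> Lower j \<notin> c \<and> Lower (j + 1) \<notin> c" if "c \<in> A'" for c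
      using that by (auto simp: A'_def)
    from this[of a] this[of b] show ?thesis
      using that out AD(5)[of a b x] by metis
  qed
  have A'_ne: "{} \<notin> A'"
    using AD(2) m by (auto simp: A'_def)
  show "partition_on (\<Union> (glue A ?G)) (insert {Bottom j, Bottom (j + 1)}
    (C ` insert m {a \<in> A. Lower j \<notin> a \<and> Lower (j + 1) \<notin> a}))"
    unfolding A'_def[symmetric]
  proof (rule partition_onI)
    have "\<Union> (insert {Bottom j, Bottom (j + 1)} (C ` A')) = {Bottom j, Bottom (j + 1)} \<union> C (\<Union> A')"
      by (auto simp: C_def)
    also have "\<dots> = \<Union> (glue A ?G)"
      unfolding Union_glue UG UA' AD(1)
      using j by (intro stack_point_setI) (auto simp: mem as_upper_layer_image_iff as_lower_layer_image_iff)
    finally show "\<Union> (insert {Bottom j, Bottom (j + 1)} (C ` A')) = \<Union> (glue A ?G)" .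
    show "{} \<notin> insert {Bottom j, Bottom (j + 1)} (C ` A')"
      using A'_ne by (auto simp: C_def)
    have d0: "disjnt {Bottom j, Bottom (j + 1)} (C a)" for a
      by (auto simp: disjnt_def mem)
    have d1: "disjnt (C a) (C b)" if "a \<in> A'" "b \<in> A'" "C a \<noteq> C b" for a b
      unfolding disjnt_iff
    proof (intro allI notI)
      fix x
      assume "x \<in> C a \<and> x \<in> C b"
      then have "a = b"
        using that A'_dis[of a b] by (cases x) (auto simp: mem)
      then show False
        using that by simp
    qed
    fix p q
    assume "p \<in> insert {Bottom j, Bottom (j + 1)} (C ` A')"
      "q \<in> insert {Bottom j, Bottom (j + 1)} (C ` A')" "p \<noteq> q"
    then show "disjnt p q"
      using d0 d1 by (auto simp: disjnt_sym)
  qed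
  show "sym ?R"
    by (rule sym_glue_rel)
  show "\<exists>D\<in>insert {Bottom j, Bottom (j + 1)}
      (C ` insert m {a \<in> A. Lower j \<notin> a \<and> Lower (j + 1) \<notin> a}). x \<in> D \<and> y \<in> D"
    if "(x, y) \<in> ?R" for x y
    unfolding A'_def[symmetric]
  proof -
    from that consider a where "a \<in> A" "{x, y} = as_upper_layer ` a"
      | i where "i \<in> {1..n} - {j, j + 1}" "{x, y} = {Middle i, Bottom i}"
      | "{x, y} = {Bottom j, Bottom (j + 1)}" | "{x, y} = {Middle j, Middle (j + 1)}"
    proof -
      assume "(x, y) \<in> ?R"
      then have "{x, y} \<in> glue A ?G" by simp
      then show thesis
      proof (rule glue_cases)
        fix a
        assume "a \<in> A" "{x, y} = as_upper_layer ` a"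
        then show thesis by (rule that(1))
      next
        fix b
        assume b: "b \<in> ?G" "{x, y} = as_lower_layer ` b"
        from b(1) consider "b = {Upper j, Upper (j + 1)}" | "b = {Lower j, Lower (j + 1)}"
          | i where "i \<in> {1..n} - {j, j + 1}" "b = {Upper i, Lower i}"
          unfolding tl_gen_diagram_def by blast
        then show thesis
        proof cases
          case 1
          with b(2) have "{x, y} = {Middle j, Middle (j + 1)}"
            by (simp only: image_insert image_empty as_lower_layer.simps)
          then show thesis by (rule that(4))
        next
          case 2
          with b(2) have "{x, y} = {Bottom j, Bottom (j + 1)}"
            by (simp only: image_insert image_empty as_lower_layer.simps)
          then show thesis by (rule that(3))
        next
          case 3
          with b(2) have "{x, y} = {Middle i, Bottom i}"
            by (simp only: image_insert image_empty as_lower_layer.simps)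
          with 3(1) show thesis by (rule that(2))
        qed
      qed
    qed
    then show "\<exists>D\<in>insert {Bottom j, Bottom (j + 1)} (C ` A'). x \<in> D \<and> y \<in> D"
    proof cases
      case 1
      then obtain b where "b \<in> A'" "a \<subseteq> b"
        using A'_sup by blast
      moreover have "x \<in> as_upper_layer ` a" "y \<in> as_upper_layer ` a"
        using 1 by blast+
      ultimately have "x \<in> C b" "y \<in> C b" by (auto simp: C_def)
      with \<open>b \<in> A'\<close> show ?thesis by blast
    next
      case 2
      then have "Lower i \<in> \<Union> A'" by (simp add: UA')
      with 2 show ?thesis by (auto simp: mem doubleton_eq_iff)
    next
      case 3
      then show ?thesis by (auto simp: doubleton_eq_iff)
    next
      case 4
      have "m \<in> A'" by (simp add: A'_def)
      with 4 m show ?thesis by (auto simp: mem doubleton_eq_iff)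
    qed
  qed
  \<comment> \<open>Points of \<open>m\<close> lie on arcs ending at \<open>Middle j\<close> or
    \<open>Middle (j + 1)\<close>, which the cup of the generator joins, so \<open>Middle j\<close>
    serves as hub. For any other block, an end of the arc does.\<close>
  have hub: "\<exists>h. \<forall>p\<in>a. (h, as_upper_layer p) \<in> ?R\<^sup>*" if "a \<in> A'" for a
  proof (cases "a = m")
    case True
    have caps: "(Middle j, Middle (j + 1)) \<in> ?R"
      using glue_lowerI[of "Upper j" "Upper (j + 1)" ?G A] by (simp add: tl_gen_diagram_def)
    have "(Middle j, as_upper_layer p) \<in> ?R\<^sup>*" if "p \<in> m" for p
    proof -
      from that obtain b where b: "b \<in> A" "p \<in> b" "Lower j \<in> b \<or> Lower (j + 1) \<in> b"
        by (auto simp: m_def)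
      have con: "(Middle i, as_upper_layer p) \<in> ?R\<^sup>*" if "Lower i \<in> b" for i
      proof (cases "p = Lower i")
        case False
        then have "b = {Lower i, p}"
          using card_2_other[OF AD(3)[OF b(1)] that] b(2) by blast
        then show ?thesis
          using b(1) glue_upperI[of "Lower i" p A ?G] by auto
      qed simp
      show ?thesis
        using b(3) con caps by (meson converse_rtrancl_into_rtrancl)
    qed
    then show ?thesis using True by blast
  next
    case False
    with that have "a \<in> A" by (auto simp: A'_def)
    then obtain p q where pq: "a = {p, q}"
      using AD(3) by (meson card_2_iff)
    then have "(as_upper_layer p, as_upper_layer r) \<in> ?R\<^sup>*" if "r \<in> a" for r
      using that \<open>a \<in> A\<close> glue_upperI[of p q A ?G] by auto
    then show ?thesis by blast
  qed
  fix D
  assume "D \<in> insert {Bottom j, Bottom (j + 1)}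
    (C ` insert m {a \<in> A. Lower j \<notin> a \<and> Lower (j + 1) \<notin> a})"
  then consider "D = {Bottom j, Bottom (j + 1)}" | a where "a \<in> A'" "D = C a"
    unfolding A'_def[symmetric] by blast
  then show "\<exists>h. \<forall>x\<in>D. (h, x) \<in> ?R\<^sup>*"
  proof cases
    case 1
    have "(Bottom j, Bottom (j + 1)) \<in> ?R"
      using glue_lowerI[of "Lower j" "Lower (j + 1)" ?G A] by (simp add: tl_gen_diagram_def)
    then show ?thesis
      using 1 by auto
  next
    case 2
    then obtain h where h: "\<forall>p\<in>a. (h, as_upper_layer p) \<in> ?R\<^sup>*"
      using hub by blast
    have "(h, x) \<in> ?R\<^sup>*" if "x \<in> D" for x
    proof (cases "x \<in> as_upper_layer ` a")
      case True
      then show ?thesis using h by blast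
    next
      case False
      with that 2 obtain i where i: "x = Bottom i" "Lower i \<in> a" "i \<noteq> j" "i \<noteq> j + 1"
        by (auto simp: C_def)
      then have "i \<in> {1..n}"
        using UA' 2(1) by (metis UnionI atLeastAtMost_iff tl_points_iff(2))
      with i have "{Upper i, Lower i} \<in> ?G"
        by (auto simp: tl_gen_diagram_def)
      then have "(Middle i, Bottom i) \<in> ?R"
        using glue_lowerI by fastforce
      moreover have "(h, Middle i) \<in> ?R\<^sup>*"
        using h i(2) by (metis as_upper_layer.simps(2))
      ultimately show ?thesis
        using i(1) by (meson rtrancl.rtrancl_into_rtrancl)
    qed
    then show ?thesis by blast
  qed
qed

lemma stack_gen_right:
  assumes A: "A \<in> tl_diagrams n n" and j: "1 \<le> j" "j < n"
  shows "stack A (tl_gen_diagram n j) = cap_off (Lower j) (Lower (j + 1)) A"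
    and "loops A (tl_gen_diagram n j) = (if {Lower j, Lower (j + 1)} \<in> A then 1 else 0)"
proof -
  note AD = tl_diagramsD[OF A]
  define C where "C \<equiv> \<lambda>a. as_upper_layer ` a \<union> Bottom ` ({i. Lower i \<in> a} - {j, j + 1})"
  define m where "m = \<Union> {a \<in> A. Lower j \<in> a \<or> Lower (j + 1) \<in> a}"
  define A0 where "A0 = {a \<in> A. Lower j \<notin> a \<and> Lower (j + 1) \<notin> a}"
  have comps: "stack_components A (tl_gen_diagram n j) =
      insert {Bottom j, Bottom (j + 1)} (C ` insert m A0)"
    unfolding C_def m_def A0_def using assms by (rule stack_gen_right_components)
  have outer: "outer_points (C a) = a - {Lower j, Lower (j + 1)}" for a
    by (rule tl_point_setI) (auto simp: C_def as_upper_layer_image_iff)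
  have outer_cap: "outer_points {Bottom j, Bottom (j + 1)} = {Lower j, Lower (j + 1)}"
    by (rule tl_point_setI) auto
  then have outer_cap_ne: "outer_points {Bottom j, Bottom (j + 1)} \<noteq> {}"
    by simp
  have A0: "outer_points (C a) = a" "a \<noteq> {}" if "a \<in> A0" for a
    using that AD(2) by (auto simp: A0_def outer)
  have "outer_points ` stack_components A (tl_gen_diagram n j) =
      insert {Lower j, Lower (j + 1)} (insert (m - {Lower j, Lower (j + 1)}) A0)"
    unfolding comps image_insert outer_cap image_image using A0(1) by (simp add: outer)
  then show "stack A (tl_gen_diagram n j) = cap_off (Lower j) (Lower (j + 1)) A"
    unfolding stack_def cap_off_def m_def[symmetric] A0_def[symmetric] using A0(2) by auto
  have "Lower j \<in> tl_points n n" "Lower (j + 1) \<in> tl_points n n"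
    using j by simp_all
  then have m: "Lower j \<in> m" "Lower (j + 1) \<in> m"
    unfolding AD(1)[symmetric] m_def by blast+
  \<comment> \<open>Only the component of \<open>m\<close> can be a closed loop, and it is one
    exactly if it contains nothing beyond the two glued points.\<close>
  have "m - {Lower j, Lower (j + 1)} = {} \<longleftrightarrow> {Lower j, Lower (j + 1)} \<in> A"
  proof
    assume sub: "m - {Lower j, Lower (j + 1)} = {}"
    obtain p where p: "{Lower j, p} \<in> A" "Lower j \<noteq> p"
      using tl_diagrams_arc[OF A \<open>Lower j \<in> tl_points n n\<close>] .
    then have "p \<in> m" by (auto simp: m_def)
    with sub p show "{Lower j, Lower (j + 1)} \<in> A" by auto
  next
    assume cap: "{Lower j, Lower (j + 1)} \<in> A"
    have "a = {Lower j, Lower (j + 1)}" if "a \<in> A" "Lower j \<in> a \<or> Lower (j + 1) \<in> a" for a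
      using AD(5)[OF that(1) cap] that(2) by blast
    then show "m - {Lower j, Lower (j + 1)} = {}"
      by (auto simp: m_def)
  qed
  moreover have "{D \<in> stack_components A (tl_gen_diagram n j). outer_points D = {}} =
      (if m - {Lower j, Lower (j + 1)} = {} then {C m} else {})"
    unfolding comps using A0 outer_cap_ne by (auto simp: outer)
  ultimately show "loops A (tl_gen_diagram n j) = (if {Lower j, Lower (j + 1)} \<in> A then 1 else 0)"
    by (simp add: loops_def)
qed

section \<open>Absorbing a generator\<close>

lemma partition_on_quotient_rtrancl:
  assumes "sym R" and "\<And>x y. (x, y) \<in> R \<Longrightarrow> y \<in> V"
  shows "partition_on V (V // R\<^sup>*)"
proof (rule partition_onI)
  have "y \<in> V" if "(x, y) \<in> R\<^sup>*" "x \<in> V" for x y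
    using that assms(2) by (induction rule: rtrancl_induct) auto
  then show "\<Union> (V // R\<^sup>*) = V"
    by (auto simp: quotient_def)
  show "{} \<notin> V // R\<^sup>*"
    by (auto simp: quotient_def)
  fix p q
  assume "p \<in> V // R\<^sup>*" "q \<in> V // R\<^sup>*" "p \<noteq> q"
  moreover have "R\<^sup>* `` {x} = R\<^sup>* `` {y}" if "(x, z) \<in> R\<^sup>*" "(y, z) \<in> R\<^sup>*" for x y z
    using that sym_rtrancl[OF assms(1)] by (auto dest: symD intro: rtrancl_trans)
  ultimately show "disjnt p q"
    unfolding disjnt_iff quotient_def by blast
qed

text \<open>As \<open>D\<close> is arbitrary apart from its cup, its components with
  \<open>A\<close> cannot be listed; the components before and after capping off are compared
  instead. The new cap and the cup of \<open>D\<close> close up to the loop \<open>M\<close>. What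
  remains of the component through \<open>M\<close> stays connected because the far ends
  \<open>p\<close> and \<open>p'\<close> of the two strands are now joined directly.\<close>

lemma stack_cap_off_components:
  assumes A: "A \<in> tl_diagrams n n" and D: "D \<in> tl_diagrams n n"
    and cup: "{Upper j, Upper (j + 1)} \<in> D" and no_cap: "{Lower j, Lower (j + 1)} \<notin> A"
  defines "M \<equiv> {Middle j, Middle (j + 1)}"
  shows "stack_components (cap_off (Lower j) (Lower (j + 1)) A) D =
      insert M ((\<lambda>C. C - M) ` stack_components A D)"
    and "partition_on (\<Union> (glue A D)) (stack_components A D)"
    and "\<And>C. C \<in> stack_components A D \<Longrightarrow> C - M \<noteq> {}"
proof -
  note AD = tl_diagramsD[OF A] and DD = tl_diagramsD[OF D]
  have "Upper j \<in> tl_points n n" "Upper (j + 1) \<in> tl_points n n"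
    using cup DD(1) by blast+
  then have pts: "Lower j \<in> tl_points n n" "Lower (j + 1) \<in> tl_points n n"
    by simp_all
  obtain p where p: "{Lower j, p} \<in> A" "Lower j \<noteq> p"
    using tl_diagrams_arc[OF A pts(1)] .
  obtain p' where p': "{Lower (j + 1), p'} \<in> A" "Lower (j + 1) \<noteq> p'"
    using tl_diagrams_arc[OF A pts(2)] .
  have ne: "p \<notin> {Lower j, Lower (j + 1)}" "p' \<notin> {Lower j, Lower (j + 1)}"
    using p p' no_cap by (auto simp: insert_commute)
  define A' where "A' = cap_off (Lower j) (Lower (j + 1)) A"
  have A': "A' = insert {Lower j, Lower (j + 1)}
      (insert {p, p'} (A - {{Lower j, p}, {Lower (j + 1), p'}}))"
    unfolding A'_def
  proof (rule cap_off_two_arcs[OF _ p(1) _ p'(1) ne])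
    show "a = {Lower j, p}" if "a \<in> A" "Lower j \<in> a" for a
      using AD(5)[OF that(1) p(1)] that(2) by simp
    show "a = {Lower (j + 1), p'}" if "a \<in> A" "Lower (j + 1) \<in> a" for a
      using AD(5)[OF that(1) p'(1)] that(2) by simp
  qed
  let ?R = "glue_rel A D" and ?R' = "glue_rel A' D"
  define V where "V = \<Union> (glue A D)"
  define P where "P = stack_components A D"
  have "\<Union> A' = \<Union> A"
    unfolding A' using p(1) p'(1) by blast
  then have V': "\<Union> (glue A' D) = V"
    unfolding V_def Union_glue by simp
  have edge_V: "x \<in> V" "y \<in> V" if "(x, y) \<in> ?R" for x y
    using that by (auto simp: V_def)
  have P: "partition_on V P"
    unfolding P_def stack_components_def V_def[symmetric]
    by (rule partition_on_quotient_rtrancl[OF sym_glue_rel edge_V(2)])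
  then show "partition_on (\<Union> (glue A D)) (stack_components A D)"
    unfolding P_def V_def .
  have symR: "sym (?R\<^sup>*)"
    by (rule sym_rtrancl[OF sym_glue_rel])
  have M_R: "(Middle j, Middle (j + 1)) \<in> ?R" "(Middle j, Middle (j + 1)) \<in> ?R'"
    using glue_lowerI[OF cup] by auto
  have p_R: "(Middle j, as_upper_layer p) \<in> ?R" "(Middle (j + 1), as_upper_layer p') \<in> ?R"
    using glue_upperI[OF p(1)] glue_upperI[OF p'(1)] by auto
  have pp'_R': "(as_upper_layer p, as_upper_layer p') \<in> ?R'"
    using glue_upperI[of p p' A' D] by (simp add: A')
  have up_M: "as_upper_layer u \<in> M \<longleftrightarrow> u = Lower j \<or> u = Lower (j + 1)" for u
    by (cases u) (auto simp: M_def)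
  have up_p: "as_upper_layer p \<notin> M" "as_upper_layer p' \<notin> M"
    using ne by (simp_all add: up_M)
  \<comment> \<open>Pushes the two glued points outwards along \<open>A\<close>; it sends paths in the old picture to paths in
     the new one.\<close>
  define r where "r x = (if x = Middle j then as_upper_layer p
      else if x = Middle (j + 1) then as_upper_layer p' else x)" for x
  have r_id: "r x = x" if "x \<notin> M" for x
    using that by (auto simp: r_def M_def)
  have r_simps: "r (Middle j) = as_upper_layer p" "r (Middle (j + 1)) = as_upper_layer p'"
    by (simp_all add: r_def)
  \<comment> \<open>The cup is itself an arc of \<open>D\<close>, so every other arc of
    \<open>D\<close> misses both of its ends.\<close>
  have lower_block: "{x, y} = M \<or> x \<notin> M \<and> y \<notin> M" if "{x, y} = as_lower_layer ` b" "b \<in> D" for x y b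
  proof (cases "b = {Upper j, Upper (j + 1)}")
    case True
    then show ?thesis using that by (simp add: M_def)
  next
    case False
    then have "Upper j \<notin> b" "Upper (j + 1) \<notin> b"
      using DD(5)[OF that(2) cup] by auto
    then have "M \<inter> as_lower_layer ` b = {}"
      by (simp add: M_def as_lower_layer_image_iff)
    then show ?thesis using that(1) by blast
  qed
  have upper_block: "x \<notin> M \<and> y \<notin> M"
    if "{x, y} = as_upper_layer ` a" "a \<in> A - {{Lower j, p}, {Lower (j + 1), p'}}" for x y a
  proof -
    have "Lower j \<notin> a" "Lower (j + 1) \<notin> a"
      using AD(5)[of a "{Lower j, p}"] AD(5)[of a "{Lower (j + 1), p'}"] that(2) p(1) p'(1) by auto
    then have "M \<inter> as_upper_layer ` a = {}"
      by (simp add: M_def as_upper_layer_image_iff)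
    then show ?thesis using that(1) by blast
  qed
  have r_edge: "(r x, r y) \<in> ?R'\<^sup>*" if "(x, y) \<in> ?R" for x y
  proof -
    consider a where "a \<in> A - {{Lower j, p}, {Lower (j + 1), p'}}" "{x, y} = as_upper_layer ` a"
      | "{x, y} = {Middle j, as_upper_layer p}"
      | "{x, y} = {Middle (j + 1), as_upper_layer p'}"
      | b where "b \<in> D" "{x, y} = as_lower_layer ` b"
    proof -
      from \<open>(x, y) \<in> ?R\<close> have g: "{x, y} \<in> glue A D" by simp
      show thesis
      proof (rule glue_cases[OF g])
        fix a
        assume a: "a \<in> A" "{x, y} = as_upper_layer ` a"
        consider "a = {Lower j, p}" | "a = {Lower (j + 1), p'}"
          | "a \<in> A - {{Lower j, p}, {Lower (j + 1), p'}}"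
          using a(1) by blast
        then show thesis
        proof cases
          case 1
          with a(2) show thesis using that(2) by simp
        next
          case 2
          with a(2) show thesis using that(3) by simp
        next
          case 3
          then show thesis using a(2) by (rule that(1))
        qed
      next
        fix b
        assume "b \<in> D" "{x, y} = as_lower_layer ` b"
        then show thesis by (rule that(4))
      qed
    qed
    then show ?thesis
    proof cases
      case 1
      then have "(x, y) \<in> ?R'"
        by (auto simp: glue_def A')
      then show ?thesis
        using upper_block[OF 1(2,1)] by (simp add: r_id r_into_rtrancl)
    next
      case 2
      then have "r x = r y"
        using r_simps r_id up_p by (auto simp: doubleton_eq_iff)
      then show ?thesis by simp
    next
      case 3
      then have "r x = r y"
        using r_simps r_id up_p by (auto simp: doubleton_eq_iff)
      then show ?thesis by simp
    next
      case 4
      from lower_block[OF 4(2,1)] show ?thesis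
      proof
        assume "{x, y} = M"
        then have "(r x, r y) \<in> ?R'"
          using pp'_R' r_simps by (auto simp: M_def doubleton_eq_iff insert_commute)
        then show ?thesis by (rule r_into_rtrancl)
      next
        assume "x \<notin> M \<and> y \<notin> M"
        moreover have "(x, y) \<in> ?R'"
          using 4 by (auto simp: glue_def)
        ultimately show ?thesis
          by (simp add: r_id r_into_rtrancl)
      qed
    qed
  qed
  have r_path: "(r x, r y) \<in> ?R'\<^sup>*" if "(x, y) \<in> ?R\<^sup>*" for x y
    using that by (induction rule: rtrancl_induct) (auto intro: rtrancl_trans r_edge)
  have P_class: "?R\<^sup>* `` {x} \<in> P" if "x \<in> V" for x
    unfolding P_def stack_components_def V_def[symmetric] using that by (rule quotientI)
  \<comment> \<open>A component that meets \<open>M\<close> also contains the far end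
    \<open>p\<close> or \<open>p'\<close> of a strand, which lies outside \<open>M\<close>.\<close>
  show nonempty: "C - M \<noteq> {}" if C: "C \<in> stack_components A D" for C
  proof -
    from C obtain z where z: "C = ?R\<^sup>* `` {z}"
      unfolding stack_components_def by (auto elim: quotientE)
    show ?thesis
    proof (cases "z \<in> M")
      case True
      then have "as_upper_layer p \<in> C \<or> as_upper_layer p' \<in> C"
        using p_R unfolding z M_def by auto
      then show ?thesis using up_p by blast
    next
      case False
      then show ?thesis using z by blast
    qed
  qed
  have "M \<subseteq> V"
    using edge_V M_R(1) by (simp add: M_def)
  show "stack_components (cap_off (Lower j) (Lower (j + 1)) A) D =
      insert M ((\<lambda>C. C - M) ` stack_components A D)"
    unfolding A'_def[symmetric] P_def[symmetric] stack_components_def[of A' D] V'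
  proof (rule quotient_rtrancl_eqI)
    show "sym ?R'" by (rule sym_glue_rel)
    show "partition_on V (insert M ((\<lambda>C. C - M) ` P))"
    proof (rule partition_onI)
      show "\<Union> (insert M ((\<lambda>C. C - M) ` P)) = V"
        using \<open>M \<subseteq> V\<close> partition_onD1[OF P] by auto
      show "{} \<notin> insert M ((\<lambda>C. C - M) ` P)"
        using nonempty by (auto simp: M_def P_def)
      fix a b
      assume "a \<in> insert M ((\<lambda>C. C - M) ` P)" "b \<in> insert M ((\<lambda>C. C - M) ` P)" "a \<noteq> b"
      then show "disjnt a b"
        using partition_onD2[OF P] by (auto simp: disjnt_def disjoint_def)
    qed
    show "\<exists>h. \<forall>x\<in>C. (h, x) \<in> ?R'\<^sup>*" if "C \<in> insert M ((\<lambda>C. C - M) ` P)" for C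
    proof (cases "C = M")
      case True
      then show ?thesis using M_R(2) by (auto simp: M_def)
    next
      case False
      with that obtain z where z: "C = ?R\<^sup>* `` {z} - M"
        unfolding P_def stack_components_def by (auto elim!: quotientE)
      \<comment> \<open>The representative \<open>z\<close> may lie in \<open>M\<close>, so the hub
        is its pushed-out image; the points of \<open>C\<close> itself are fixed by
        \<open>r\<close>.\<close>
      have "(r z, x) \<in> ?R'\<^sup>*" if "x \<in> C" for x
        using r_path[of z x] r_id[of x] that z by simp
      then show ?thesis by blast
    qed
    show "\<exists>C\<in>insert M ((\<lambda>C. C - M) ` P). x \<in> C \<and> y \<in> C" if "(x, y) \<in> ?R'" for x y
    proof (cases "{x, y} = M")
      case True
      then show ?thesis by blast
    next
      case False
      \<comment> \<open>The new arc abbreviates an old path: along one strand to \<open>M\<close>,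
        through the cup of \<open>D\<close>, and out along the other strand.\<close>
      have pp': "(as_upper_layer p, as_upper_layer p') \<in> ?R\<^sup>*"
        using p_R M_R(1) symR by (meson rtrancl.rtrancl_into_rtrancl r_into_rtrancl rtrancl_trans symD)
      consider a where "a \<in> A - {{Lower j, p}, {Lower (j + 1), p'}}" "{x, y} = as_upper_layer ` a"
        | "{x, y} = M" | "{x, y} = {as_upper_layer p, as_upper_layer p'}"
        | b where "b \<in> D" "{x, y} = as_lower_layer ` b"
      proof -
        from \<open>(x, y) \<in> ?R'\<close> have g: "{x, y} \<in> glue A' D" by simp
        show thesis
        proof (rule glue_cases[OF g])
          fix a
          assume a: "a \<in> A'" "{x, y} = as_upper_layer ` a"
          consider "a = {Lower j, Lower (j + 1)}" | "a = {p, p'}"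
            | "a \<in> A - {{Lower j, p}, {Lower (j + 1), p'}}"
            using a(1) unfolding A' by blast
          then show thesis
          proof cases
            case 1
            with a(2) show thesis using that(2) by (simp add: M_def)
          next
            case 2
            with a(2) show thesis using that(3) by simp
          next
            case 3
            then show thesis using a(2) by (rule that(1))
          qed
        next
          fix b
          assume "b \<in> D" "{x, y} = as_lower_layer ` b"
          then show thesis by (rule that(4))
        qed
      qed
      then have xy: "x \<notin> M \<and> y \<notin> M \<and> (x, y) \<in> ?R\<^sup>*"
      proof cases
        case 1
        then have "(x, y) \<in> ?R"
          by (auto simp: glue_def)
        then show ?thesis
          using upper_block[OF 1(2,1)] by blast
      next
        case 2
        then show ?thesis using False by blast
      next
        case 3
        then show ?thesis
          using up_p pp' symD[OF symR pp'] by (auto simp: doubleton_eq_iff)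
      next
        case 4
        then have "(x, y) \<in> ?R"
          by (auto simp: glue_def)
        then show ?thesis
          using lower_block[OF 4(2,1)] False by blast
      qed
      have "x \<in> V"
        using that V' by auto
      then have "?R\<^sup>* `` {x} - M \<in> insert M ((\<lambda>C. C - M) ` P)"
        using P_class by blast
      moreover have "x \<in> ?R\<^sup>* `` {x} - M" "y \<in> ?R\<^sup>* `` {x} - M"
        using xy by auto
      ultimately show ?thesis by blast
    qed
  qed
qed

lemma stack_cap_off:
  assumes A: "A \<in> tl_diagrams n n" and D: "D \<in> tl_diagrams n n"
    and cup: "{Upper j, Upper (j + 1)} \<in> D" and no_cap: "{Lower j, Lower (j + 1)} \<notin> A"
  shows "stack (cap_off (Lower j) (Lower (j + 1)) A) D = stack A D"
    and "loops (cap_off (Lower j) (Lower (j + 1)) A) D = Suc (loops A D)"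
proof -
  define M where "M = {Middle j, Middle (j + 1)}"
  define P where "P = stack_components A D"
  note comps = stack_cap_off_components[OF assms, folded M_def, folded P_def]
  have outer: "outer_points (C - M) = outer_points C" "outer_points M = {}" for C
    by (rule tl_point_setI; simp add: M_def)+
  show "stack (cap_off (Lower j) (Lower (j + 1)) A) D = stack A D"
    unfolding stack_def comps(1) P_def[symmetric] image_insert image_image outer by simp
  have "finite (\<Union> (glue A D))"
    unfolding Union_glue tl_diagramsD(1)[OF A] tl_diagramsD(1)[OF D] by (simp add: tl_points_def)
  then have "finite P"
    using comps(2) by (rule finite_elements)
  \<comment> \<open>Each component keeps a point outside \<open>M\<close>, so removing
    \<open>M\<close> identifies no two of them and the old loops are still counted
    separately.\<close>
  have inj: "inj_on (\<lambda>C. C - M) P"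
  proof (rule inj_onI)
    fix C C'
    assume C: "C \<in> P" "C' \<in> P" "C - M = C' - M"
    then obtain z where "z \<in> C" "z \<in> C'"
      using comps(3) by blast
    then show "C = C'"
      using C partition_onD2[OF comps(2)] by (meson disjointD disjoint_iff)
  qed
  have "{C \<in> insert M ((\<lambda>C. C - M) ` P). outer_points C = {}} =
      insert M ((\<lambda>C. C - M) ` {C \<in> P. outer_points C = {}})"
    using outer by auto
  moreover have "M \<notin> (\<lambda>C. C - M) ` {C \<in> P. outer_points C = {}}"
    by (auto simp: M_def)
  moreover have "card ((\<lambda>C. C - M) ` {C \<in> P. outer_points C = {}}) = card {C \<in> P. outer_points C = {}}"
    using inj by (intro card_image) (auto intro: inj_on_subset)
  ultimately show "loops (cap_off (Lower j) (Lower (j + 1)) A) D = Suc (loops A D)"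
    unfolding loops_def comps(1) P_def[symmetric] using \<open>finite P\<close> by simp
qed

text \<open>On basis diagrams this is \<open>(A e_j) D = - [2] (A D)\<close>. If \<open>A\<close>
  has a cap at \<open>j\<close>, the extra loop appears in the first stacking, which leaves
  \<open>A\<close> unchanged; otherwise it appears in the second.\<close>

lemma stack_stack_gen:
  assumes A: "A \<in> tl_diagrams n n" and D: "D \<in> tl_diagrams n n" and cup: "{Upper j, Upper (j + 1)} \<in> D"
  shows "stack (stack A (tl_gen_diagram n j)) D = stack A D"
    and "loops A (tl_gen_diagram n j) + loops (stack A (tl_gen_diagram n j)) D = Suc (loops A D)"
proof -
  have "Upper j \<in> tl_points n n" "Upper (j + 1) \<in> tl_points n n"
    using cup tl_diagramsD(1)[OF D] by blast+
  then have j: "1 \<le> j" "j < n"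
    by simp_all
  note gen = stack_gen_right[OF A j]
  have "cap_off (Lower j) (Lower (j + 1)) A = A" if cap: "{Lower j, Lower (j + 1)} \<in> A"
  proof (rule cap_off_arc[OF _ cap])
    show "a = {Lower j, Lower (j + 1)}" if "a \<in> A" "Lower j \<in> a \<or> Lower (j + 1) \<in> a" for a
      using tl_diagramsD(5)[OF A that(1) cap] that(2) by blast
  qed
  then show "stack (stack A (tl_gen_diagram n j)) D = stack A D"
    "loops A (tl_gen_diagram n j) + loops (stack A (tl_gen_diagram n j)) D = Suc (loops A D)"
    using stack_cap_off[OF A D cup] unfolding gen by (cases "{Lower j, Lower (j + 1)} \<in> A"; simp)+
qed

lemma loop_value_nonzero: "- qint 2 \<noteq> 0"
  using qint_nonzero[of 2] by simp

text \<open>Multiplying \<open>x e_j = 0\<close> by \<open>D\<close> on the right gives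
  \<open>- [2]\<close> times \<open>x D\<close>, and the loop value can be cancelled.\<close>

lemma tl_mult_cup_eq_0:
  assumes x: "x \<in> TL n n" "x \<circledast> tl_gen n j = 0"
    and D: "D \<in> tl_diagrams n n" "{Upper j, Upper (j + 1)} \<in> D"
  shows "x \<circledast> Poly_Mapping.single D 1 = 0"
proof (rule poly_mapping_eqI)
  fix E
  let ?w = "- qint 2" and ?e = "tl_gen_diagram n j"
  have keys: "A \<in> tl_diagrams n n" if "A \<in> Poly_Mapping.keys x" for A
    using that x(1) by (auto simp: TL_def)
  have "0 = tl_lin (\<lambda>A. stack A D) (\<lambda>A. ?w ^ loops A D) (x \<circledast> tl_gen n j)"
    by (simp add: x(2))
  also have "\<dots> = tl_lin (\<lambda>A. stack (stack A ?e) D)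
      (\<lambda>A. ?w ^ loops A ?e * ?w ^ loops (stack A ?e) D) x"
    unfolding tl_gen_def tl_mult_single tl_lin_tl_lin ..
  also have "\<dots> = tl_lin (\<lambda>A. stack A D) (\<lambda>A. ?w * ?w ^ loops A D) x"
    using stack_stack_gen[OF keys D] unfolding power_add[symmetric] power_Suc[symmetric]
    by (intro tl_lin_cong) simp_all
  finally have "?w * Poly_Mapping.lookup (x \<circledast> Poly_Mapping.single D 1) E = 0"
    unfolding tl_mult_single lookup_tl_lin_scale[symmetric] by simp
  then show "Poly_Mapping.lookup (x \<circledast> Poly_Mapping.single D 1) E = Poly_Mapping.lookup 0 E"
    using loop_value_nonzero by (simp only: mult_eq_0_iff lookup_zero simp_thms)
qed

section \<open>Upside-down reflection and uniqueness\<close>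

fun flip_point :: "tl_point \<Rightarrow> tl_point" where
  "flip_point (Upper i) = Lower i"
| "flip_point (Lower i) = Upper i"

fun flip_stack_point :: "stack_point \<Rightarrow> stack_point" where
  "flip_stack_point (Top i) = Bottom i"
| "flip_stack_point (Middle i) = Middle i"
| "flip_stack_point (Bottom i) = Top i"

definition tl_flip_diagram :: "diagram \<Rightarrow> diagram" where
  "tl_flip_diagram D = (`) flip_point ` D"

lemma flip_point_flip_point [simp]: "flip_point (flip_point x) = x"
  by (cases x) simp_all

lemma inj_flip_point: "inj flip_point"
  by (metis flip_point_flip_point injI)

lemma flip_stack_point_flip_stack_point [simp]: "flip_stack_point (flip_stack_point x) = x"
  by (cases x) simp_all

lemma inj_flip_stack_point: "inj flip_stack_point"
  by (metis flip_stack_point_flip_stack_point injI)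

lemma tl_flip_diagram_flip [simp]: "tl_flip_diagram (tl_flip_diagram D) = D"
  by (simp add: tl_flip_diagram_def image_image)

lemma inj_tl_flip_diagram: "inj tl_flip_diagram"
  by (metis tl_flip_diagram_flip injI)

lemma boundary_pos_flip: "boundary_pos (flip_point x) = - boundary_pos x"
  by (cases x) simp_all

lemma doubleton_mem_tl_flip_diagram:
  "{x, y} \<in> tl_flip_diagram D \<longleftrightarrow> {flip_point x, flip_point y} \<in> D"
proof -
  have "{x, y} = flip_point ` {flip_point x, flip_point y}"
    by simp
  then show ?thesis
    unfolding tl_flip_diagram_def using inj_flip_point by (metis inj_image_mem_iff inj_image_eq_iff injI)
qed

lemma tl_flip_diagram_tl_diagrams:
  assumes D: "D \<in> tl_diagrams n m"
  shows "tl_flip_diagram D \<in> tl_diagrams m n"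
  unfolding tl_diagrams_def
proof (intro CollectI conjI ballI)
  have img: "flip_point ` tl_points n m = tl_points m n"
  proof (rule tl_point_setI)
    have *: "x \<in> flip_point ` S \<longleftrightarrow> flip_point x \<in> S" for x S
      by (metis flip_point_flip_point image_iff)
    show "Upper i \<in> flip_point ` tl_points n m \<longleftrightarrow> Upper i \<in> tl_points m n"
      "Lower i \<in> flip_point ` tl_points n m \<longleftrightarrow> Lower i \<in> tl_points m n" for i
      by (simp_all add: *)
  qed
  have "{} \<notin> tl_flip_diagram D"
    using tl_diagramsD(2)[OF D] by (auto simp: tl_flip_diagram_def)
  then show "partition_on (tl_points m n) (tl_flip_diagram D)"
    using partition_on_inj_image[OF tl_diagramsD(6)[OF D] inj_on_subset[OF inj_flip_point subset_UNIV]]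
    by (simp add: img tl_flip_diagram_def)
  show "card a = 2" if "a \<in> tl_flip_diagram D" for a
    using that tl_diagramsD(3)[OF D] card_image[OF inj_on_subset[OF inj_flip_point subset_UNIV]]
    by (auto simp: tl_flip_diagram_def)
  show "noncrossing (tl_flip_diagram D)"
    unfolding noncrossing_def
  proof clarify
    fix a b c d
    assume "{a, b} \<in> tl_flip_diagram D" "{c, d} \<in> tl_flip_diagram D"
      and pos: "boundary_pos a < boundary_pos c" "boundary_pos c < boundary_pos b"
      "boundary_pos b < boundary_pos d"
    then have "{flip_point b, flip_point a} \<in> D" "{flip_point d, flip_point c} \<in> D"
      by (simp_all add: doubleton_mem_tl_flip_diagram insert_commute)
    moreover have "boundary_pos (flip_point d) < boundary_pos (flip_point b)"
      "boundary_pos (flip_point b) < boundary_pos (flip_point c)"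
      "boundary_pos (flip_point c) < boundary_pos (flip_point a)"
      using pos by (simp_all add: boundary_pos_flip)
    ultimately show False
      using tl_diagramsD(4)[OF D] unfolding noncrossing_def by blast
  qed
qed

lemma glue_flip: "glue (tl_flip_diagram B) (tl_flip_diagram A) = (`) flip_stack_point ` glue A B"
proof -
  have "as_upper_layer (flip_point x) = flip_stack_point (as_lower_layer x)"
    "as_lower_layer (flip_point x) = flip_stack_point (as_upper_layer x)" for x
    by (cases x; simp)+
  then show ?thesis
    by (simp add: glue_def tl_flip_diagram_def image_Un image_image Un_commute)
qed

text \<open>Reflection is an isomorphism between the two glued graphs and so carries components to
  components; since the layers trade places, the factors are reversed.\<close>

lemma stack_components_flip:
  "stack_components (tl_flip_diagram B) (tl_flip_diagram A) =
     (`) flip_stack_point ` stack_components A B"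
proof -
  let ?f = flip_stack_point
  let ?R = "glue_rel A B" and ?R' = "glue_rel (tl_flip_diagram B) (tl_flip_diagram A)"
  have edge: "(x, y) \<in> ?R' \<longleftrightarrow> (?f x, ?f y) \<in> ?R" for x y
  proof -
    have "{x, y} = ?f ` {?f x, ?f y}"
      by simp
    then show ?thesis
      unfolding glue_flip mem_Collect_eq case_prod_conv
      using inj_flip_stack_point by (metis inj_image_mem_iff inj_image_eq_iff injI)
  qed
  have path: "(?f x, ?f y) \<in> ?R\<^sup>*" if "(x, y) \<in> ?R'\<^sup>*" for x y
    using that
  proof (induction rule: rtrancl_induct)
    case (step y z)
    have "(?f y, ?f z) \<in> ?R"
      using step(2) by (simp only: edge)
    with step(3) show ?case
      by (rule rtrancl_into_rtrancl)
  qed simp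
  have path': "(?f x, ?f y) \<in> ?R'\<^sup>*" if "(x, y) \<in> ?R\<^sup>*" for x y
    using that
  proof (induction rule: rtrancl_induct)
    case (step y z)
    have "(?f y, ?f z) \<in> ?R'"
      using step(2) by (simp only: edge flip_stack_point_flip_stack_point)
    with step(3) show ?case
      by (rule rtrancl_into_rtrancl)
  qed simp
  have cls: "?R'\<^sup>* `` {?f x} = ?f ` (?R\<^sup>* `` {x})" for x
  proof
    show "?R'\<^sup>* `` {?f x} \<subseteq> ?f ` (?R\<^sup>* `` {x})"
    proof
      fix y
      assume "y \<in> ?R'\<^sup>* `` {?f x}"
      then have "(x, ?f y) \<in> ?R\<^sup>*"
        using path[of "?f x" y] by simp
      then have "?f (?f y) \<in> ?f ` (?R\<^sup>* `` {x})" by blast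
      then show "y \<in> ?f ` (?R\<^sup>* `` {x})" by simp
    qed
    show "?f ` (?R\<^sup>* `` {x}) \<subseteq> ?R'\<^sup>* `` {?f x}"
      using path' by blast
  qed
  have "\<Union> (glue (tl_flip_diagram B) (tl_flip_diagram A)) = ?f ` \<Union> (glue A B)"
    unfolding glue_flip by blast
  then show ?thesis
    unfolding stack_components_def quotient_def by (simp add: cls image_UN)
qed

lemma outer_points_flip: "outer_points (flip_stack_point ` C) = flip_point ` outer_points C"
proof -
  have f: "x \<in> flip_stack_point ` C \<longleftrightarrow> flip_stack_point x \<in> C" for x
    by (metis flip_stack_point_flip_stack_point image_iff)
  have g: "x \<in> flip_point ` S \<longleftrightarrow> flip_point x \<in> S" for x S
    by (metis flip_point_flip_point image_iff)
  show ?thesis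
    by (rule tl_point_setI) (simp_all add: f g)
qed

lemma stack_flip: "stack (tl_flip_diagram B) (tl_flip_diagram A) = tl_flip_diagram (stack A B)"
proof -
  have "inj ((`) flip_point)"
    using inj_flip_point by (metis inj_image_eq_iff injI)
  then show ?thesis
    unfolding stack_def stack_components_flip tl_flip_diagram_def[of "_ - _"]
    by (simp add: image_set_diff image_image outer_points_flip)
qed

lemma loops_flip: "loops (tl_flip_diagram B) (tl_flip_diagram A) = loops A B"
proof -
  have "{C \<in> (`) flip_stack_point ` stack_components A B. outer_points C = {}} =
      (`) flip_stack_point ` {C \<in> stack_components A B. outer_points C = {}}"
    by (auto simp: outer_points_flip)
  moreover have "inj ((`) flip_stack_point)"
    using inj_flip_stack_point by (metis inj_image_eq_iff injI)
  ultimately show ?thesis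
    unfolding loops_def stack_components_flip by (simp add: card_image inj_on_subset)
qed

lemma tl_flip_id_diagram: "tl_flip_diagram (tl_id_diagram n) = tl_id_diagram n"
  by (simp add: tl_flip_diagram_def tl_id_diagram_def image_image insert_commute)

lemma tl_flip_gen_diagram: "tl_flip_diagram (tl_gen_diagram n i) = tl_gen_diagram n i"
  by (simp add: tl_flip_diagram_def tl_gen_diagram_def image_image image_Un insert_commute)

section \<open>Reflection on the algebra\<close>

definition tl_flip :: "tl_element \<Rightarrow> tl_element" where
  "tl_flip x = tl_lin tl_flip_diagram (\<lambda>_. 1) x"

lemma lookup_tl_flip:
  "Poly_Mapping.lookup (tl_flip x) D = Poly_Mapping.lookup x (tl_flip_diagram D)"
  using lookup_tl_lin_inj[OF inj_on_subset[OF inj_tl_flip_diagram subset_UNIV],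
      where A = "tl_flip_diagram D" and k = "\<lambda>_. 1"]
  by (simp add: tl_flip_def)

lemma keys_tl_flip: "Poly_Mapping.keys (tl_flip x) = tl_flip_diagram ` Poly_Mapping.keys x"
proof (rule set_eqI)
  fix D
  show "D \<in> Poly_Mapping.keys (tl_flip x) \<longleftrightarrow> D \<in> tl_flip_diagram ` Poly_Mapping.keys x"
    using inj_image_mem_iff[OF inj_tl_flip_diagram, of "tl_flip_diagram D" "Poly_Mapping.keys x"]
    by (simp add: in_keys_iff lookup_tl_flip)
qed

lemma tl_flip_0 [simp]: "tl_flip 0 = 0"
  by (simp add: tl_flip_def)

lemma tl_flip_single: "tl_flip (Poly_Mapping.single D c) = Poly_Mapping.single (tl_flip_diagram D) c"
  by (simp add: tl_flip_def tl_lin_single)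

lemma tl_flip_gen: "tl_flip (tl_gen n i) = tl_gen n i"
  by (simp add: tl_gen_def tl_flip_single tl_flip_gen_diagram)

lemma tl_flip_TL: "x \<in> TL n m \<Longrightarrow> tl_flip x \<in> TL m n"
  using tl_flip_diagram_tl_diagrams by (auto simp: TL_def keys_tl_flip)

text \<open>Reflection reverses products and fixes the generators, so it exchanges annihilation on
  the right with annihilation on the left.\<close>

lemma tl_flip_mult: "tl_flip (x \<circledast> y) = tl_flip y \<circledast> tl_flip x"
proof -
  have inj: "inj_on tl_flip_diagram S" for S
    using inj_tl_flip_diagram by (rule inj_on_subset) simp
  have "tl_flip y \<circledast> tl_flip x =
      (\<Sum>B\<in>Poly_Mapping.keys y. \<Sum>A\<in>Poly_Mapping.keys x.
        Poly_Mapping.single (tl_flip_diagram (stack A B))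
          (Poly_Mapping.lookup y B * Poly_Mapping.lookup x A * (- qint 2) ^ loops A B))"
    by (simp add: tl_mult_def keys_tl_flip sum.reindex[OF inj] lookup_tl_flip stack_flip loops_flip)
  also have "\<dots> = tl_flip (x \<circledast> y)"
    unfolding tl_mult_def tl_flip_def tl_lin_sum tl_lin_single
    by (subst sum.swap) (simp add: mult.commute)
  finally show ?thesis ..
qed

text \<open>
  A diagram without caps joins every lower point to an upper one, and noncrossing forces this
  bijection to be increasing.
\<close>

lemma tl_diagram_has_cap:
  assumes D: "D \<in> tl_diagrams n n" and "D \<noteq> tl_id_diagram n"
  obtains j where "1 \<le> j" "j < n" "{Lower j, Lower (j + 1)} \<in> D"
proof (cases "\<exists>a b. a < b \<and> {Lower a, Lower b} \<in> D")
  case True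
  then have "\<exists>k a. k > 0 \<and> {Lower a, Lower (a + k)} \<in> D"
    by (metis less_imp_add_positive)
  \<comment> \<open>A cap of least width can have no cap nested inside it, hence it joins adjacent
    points.\<close>
  then obtain k where k: "\<exists>a. k > 0 \<and> {Lower a, Lower (a + k)} \<in> D"
    and least: "\<And>k'. k' < k \<Longrightarrow> \<not> (\<exists>a. k' > 0 \<and> {Lower a, Lower (a + k')} \<in> D)"
    using exists_least_iff[of "\<lambda>k. \<exists>a. k > 0 \<and> {Lower a, Lower (a + k)} \<in> D"] by blast
  from k obtain a where a: "k > 0" "{Lower a, Lower (a + k)} \<in> D" by blast
  have "\<nexists>c d. {Lower c, Lower d} \<in> D \<and> a < c \<and> c < d \<and> d < a + k"
  proof clarify
    fix c d
    assume cd: "{Lower c, Lower d} \<in> D" "a < c" "c < d" "d < a + k"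
    then have "d = c + (d - c)" "d - c < k" "d - c > 0"
      by simp_all
    then show False
      using least[of "d - c"] cd(1) by metis
  qed
  then have "a + k = a + 1"
    using innermost_cap_iff[OF D a(2)] a(1) by simp
  then have cap: "{Lower a, Lower (a + 1)} \<in> D"
    using a(2) by simp
  then have "Lower a \<in> tl_points n n" "Lower (a + 1) \<in> tl_points n n"
    using tl_diagramsD(1)[OF D] by blast+
  then show thesis
    using that cap by simp
next
  case False
  note DD = tl_diagramsD[OF D]
  have "\<exists>k. {Upper k, Lower i} \<in> D" if i: "i \<in> {1..n}" for i
  proof -
    have "Lower i \<in> tl_points n n"
      using i by simp
    then obtain y where y: "{Lower i, y} \<in> D" "Lower i \<noteq> y"
      using tl_diagrams_arc[OF D] by blast
    show ?thesis
    proof (cases y)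
      case (Upper k)
      then show ?thesis using y(1) by (auto simp: insert_commute)
    next
      case (Lower k)
      then have "i < k \<or> k < i" "{Lower i, Lower k} \<in> D" "{Lower k, Lower i} \<in> D"
        using y by (auto simp: insert_commute)
      then show ?thesis using False by blast
    qed
  qed
  then obtain u where u: "\<And>i. i \<in> {1..n} \<Longrightarrow> {Upper (u i), Lower i} \<in> D"
    by metis
  have u_range: "u i \<in> {1..n}" if "i \<in> {1..n}" for i
  proof -
    have "Upper (u i) \<in> \<Union> D"
      using u[OF that] by blast
    then show ?thesis by (simp add: DD(1))
  qed
  have u_mono: "u i < u j" if ij: "i \<in> {1..n}" "j \<in> {1..n}" "i < j" for i j
  proof (rule ccontr)
    assume "\<not> u i < u j"
    moreover have "u i \<noteq> u j"
    proof
      assume "u i = u j"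
      then have "{Upper (u i), Lower i} = {Upper (u j), Lower j}"
        using DD(5)[OF u[OF ij(1)] u[OF ij(2)], of "Upper (u i)"] by simp
      then show False
        using ij(3) by (simp add: doubleton_eq_iff)
    qed
    ultimately have "u j < u i" by simp
    moreover have "{Lower j, Upper (u j)} \<in> D" "{Lower i, Upper (u i)} \<in> D"
      using u ij by (simp_all add: insert_commute)
    moreover have "0 < u j"
      using u_range[OF ij(2)] by simp
    moreover have nc: False if "{a, b} \<in> D" "{c, d} \<in> D" "boundary_pos a < boundary_pos c"
      "boundary_pos c < boundary_pos b" "boundary_pos b < boundary_pos d" for a b c d
      using DD(4) that unfolding noncrossing_def by blast
    ultimately show False
      using nc[of "Lower j" "Upper (u j)" "Lower i" "Upper (u i)"] ij(3) by simp
  qed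
  \<comment> \<open>A strictly increasing self-map of \<open>{1..n}\<close> is the identity:
    induction upwards from 1 gives \<open>i \<le> u i\<close>, and induction downwards from
    \<open>n\<close>, written with \<open>n - k\<close>, gives the reverse inequality.\<close>
  have ge: "i \<in> {1..n} \<Longrightarrow> i \<le> u i" for i
  proof (induction i)
    case (Suc i)
    show ?case
    proof (cases "i = 0")
      case True
      then show ?thesis using u_range[OF Suc.prems] by simp
    next
      case False
      then have "i \<in> {1..n}" using Suc.prems by simp
      then show ?thesis
        using Suc.IH u_mono[OF _ Suc.prems, of i] by simp
    qed
  qed simp
  have le: "n - k \<in> {1..n} \<Longrightarrow> u (n - k) \<le> n - k" for k
  proof (induction k)
    case 0
    then show ?case using u_range by simp
  next
    case (Suc k)
    then have "n - k \<in> {1..n}" "n - Suc k < n - k" by auto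
    then show ?case
      using Suc.IH u_mono[OF Suc.prems, of "n - k"] by linarith
  qed
  have u_id: "u i = i" if i: "i \<in> {1..n}" for i
    using ge[OF i] le[of "n - i"] i by simp
  have sub: "tl_id_diagram n \<subseteq> D"
    using u u_id by (auto simp: tl_id_diagram_def)
  have "a \<in> tl_id_diagram n" if a: "a \<in> D" for a
  proof -
    obtain x where x: "x \<in> a" using DD(2) a by (metis ex_in_conv)
    then have "x \<in> tl_points n n" using a DD(1) by blast
    then have "\<exists>b\<in>tl_id_diagram n. x \<in> b"
      by (cases x) (auto simp: tl_id_diagram_def)
    then show ?thesis
      using DD(5)[OF a] sub x by blast
  qed
  with sub have "D = tl_id_diagram n" by blast
  with assms(2) show thesis by simp
qed

section \<open>Products with annihilated elements, and uniqueness\<close>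

lemma lookup_tl_mult_right:
  assumes x: "x \<in> TL n n" "\<And>j. j \<in> {1..<n} \<Longrightarrow> x \<circledast> tl_gen n j = 0" and y: "y \<in> TL n n"
  shows "Poly_Mapping.lookup (x \<circledast> y) D =
    Poly_Mapping.lookup y (tl_id_diagram n) * Poly_Mapping.lookup x D"
proof -
  have zero: "x \<circledast> Poly_Mapping.single B 1 = 0" if B: "B \<in> tl_diagrams n n" "B \<noteq> tl_id_diagram n" for B
  proof -
    \<comment> \<open>A cup of \<open>B\<close> on the upper edge is wanted; it is a cap of the
      reflected diagram.\<close>
    have "tl_flip_diagram B \<noteq> tl_id_diagram n"
      using B(2) tl_flip_id_diagram tl_flip_diagram_flip by metis
    then obtain j where j: "1 \<le> j" "j < n" "{Lower j, Lower (j + 1)} \<in> tl_flip_diagram B"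
      using tl_diagram_has_cap[OF tl_flip_diagram_tl_diagrams[OF B(1)]] by blast
    then have "{Upper j, Upper (j + 1)} \<in> B"
      by (simp add: doubleton_mem_tl_flip_diagram)
    then show ?thesis
      using tl_mult_cup_eq_0[OF x(1) x(2) B(1)] j by simp
  qed
  have "x \<circledast> Poly_Mapping.single (tl_id_diagram n) 1 = tl_lin (\<lambda>A. A) (\<lambda>_. 1) x"
    unfolding tl_mult_single using x(1) by (intro tl_lin_cong) (auto simp: TL_def stack_id_right subset_iff)
  then have one: "Poly_Mapping.lookup (x \<circledast> Poly_Mapping.single (tl_id_diagram n) 1) D = Poly_Mapping.lookup x D"
    using lookup_tl_lin_inj[of "\<lambda>A. A" D x "\<lambda>_. 1"] by simp
  have "Poly_Mapping.lookup (x \<circledast> y) D = (\<Sum>B\<in>Poly_Mapping.keys y.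
      if B = tl_id_diagram n then Poly_Mapping.lookup y (tl_id_diagram n) * Poly_Mapping.lookup x D else 0)"
    unfolding lookup_tl_mult[of x y]
  proof (rule sum.cong)
    fix B
    assume "B \<in> Poly_Mapping.keys y"
    then have "B \<in> tl_diagrams n n"
      using y by (auto simp: TL_def)
    then show "Poly_Mapping.lookup y B * Poly_Mapping.lookup (x \<circledast> Poly_Mapping.single B 1) D =
        (if B = tl_id_diagram n then Poly_Mapping.lookup y (tl_id_diagram n) * Poly_Mapping.lookup x D else 0)"
      by (cases "B = tl_id_diagram n") (simp_all add: zero one)
  qed simp
  also have "\<dots> = Poly_Mapping.lookup y (tl_id_diagram n) * Poly_Mapping.lookup x D"
    by (simp add: in_keys_iff)
  finally show ?thesis .
qed

lemma lookup_tl_mult_left: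
  assumes x: "x \<in> TL n n" "\<And>j. j \<in> {1..<n} \<Longrightarrow> tl_gen n j \<circledast> x = 0" and y: "y \<in> TL n n"
  shows "Poly_Mapping.lookup (y \<circledast> x) D =
    Poly_Mapping.lookup y (tl_id_diagram n) * Poly_Mapping.lookup x D"
proof -
  have "tl_flip x \<circledast> tl_gen n j = 0" if "j \<in> {1..<n}" for j
    using x(2)[OF that] tl_flip_mult[of "tl_gen n j" x] by (simp add: tl_flip_gen)
  from lookup_tl_mult_right[OF tl_flip_TL[OF x(1)] this tl_flip_TL[OF y], of "tl_flip_diagram D"]
  show ?thesis
    unfolding tl_flip_mult[symmetric] by (simp add: lookup_tl_flip tl_flip_id_diagram)
qed

text \<open>
  Annihilation on one side suffices: \<open>f \<circledast> tl_flip f\<close> equals both \<open>f\<close> and \<open>tl_flip f\<close>, so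
  \<open>f\<close> is symmetric.
\<close>

lemma jones_wenzl_eqI:
  assumes f: "f \<in> TL n n" "\<And>j. j \<in> {1..<n} \<Longrightarrow> f \<circledast> tl_gen n j = 0"
    and id: "Poly_Mapping.lookup f (tl_id_diagram n) = 1"
  shows "jones_wenzl n = f"
proof -
  have flip_f: "tl_flip f \<in> TL n n" "\<And>j. j \<in> {1..<n} \<Longrightarrow> tl_gen n j \<circledast> tl_flip f = 0"
    "Poly_Mapping.lookup (tl_flip f) (tl_id_diagram n) = 1"
  proof -
    show "tl_flip f \<in> TL n n"
      using f(1) by (rule tl_flip_TL)
    show "tl_gen n j \<circledast> tl_flip f = 0" if "j \<in> {1..<n}" for j
      using tl_flip_mult[of f "tl_gen n j"] by (simp add: f(2)[OF that] tl_flip_gen)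
    show "Poly_Mapping.lookup (tl_flip f) (tl_id_diagram n) = 1"
      by (simp add: lookup_tl_flip tl_flip_id_diagram id)
  qed
  have sym_f: "tl_flip f = f"
  proof (rule poly_mapping_eqI)
    fix D
    show "Poly_Mapping.lookup (tl_flip f) D = Poly_Mapping.lookup f D"
      using lookup_tl_mult_right[OF f flip_f(1), of D] lookup_tl_mult_left[OF flip_f(1,2) f(1), of D]
      by (simp add: id flip_f(3))
  qed
  have f': "tl_gen n j \<circledast> f = 0" if "j \<in> {1..<n}" for j
    using flip_f(2)[OF that] by (simp only: sym_f)
  show ?thesis
    unfolding jones_wenzl_def
  proof (rule the_equality)
    have "f \<circledast> f = f"
    proof (rule poly_mapping_eqI)
      fix D
      show "Poly_Mapping.lookup (f \<circledast> f) D = Poly_Mapping.lookup f D"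
        using lookup_tl_mult_right[OF f f(1), of D] id by simp
    qed
    moreover have "f \<noteq> 0"
      using id by auto
    ultimately show "f \<in> TL n n \<and> f \<noteq> 0 \<and> f \<circledast> f = f \<and>
        (\<forall>i\<in>{1..<n}. tl_gen n i \<circledast> f = 0 \<and> f \<circledast> tl_gen n i = 0)"
      using f f' by blast
  next
    fix g
    assume g: "g \<in> TL n n \<and> g \<noteq> 0 \<and> g \<circledast> g = g \<and>
        (\<forall>i\<in>{1..<n}. tl_gen n i \<circledast> g = 0 \<and> g \<circledast> tl_gen n i = 0)"
    then have g_TL: "g \<in> TL n n" and gg: "g \<circledast> g = g"
      and g_left: "\<And>j. j \<in> {1..<n} \<Longrightarrow> tl_gen n j \<circledast> g = 0"
      and g_right: "\<And>j. j \<in> {1..<n} \<Longrightarrow> g \<circledast> tl_gen n j = 0"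
      by blast+
    define c where "c = Poly_Mapping.lookup g (tl_id_diagram n)"
    \<comment> \<open>The product \<open>f \<circledast> g\<close> is evaluated twice:
      \<open>g\<close> is annihilated on the left and \<open>f\<close> has identity coefficient 1,
      which gives \<open>g\<close>; \<open>f\<close> is annihilated on the right, which gives
      \<open>c\<close> times \<open>f\<close>.\<close>
    have g_f: "Poly_Mapping.lookup g D = c * Poly_Mapping.lookup f D" for D
    proof -
      have "Poly_Mapping.lookup g D = Poly_Mapping.lookup (f \<circledast> g) D"
        using lookup_tl_mult_left[OF g_TL g_left f(1), of D] id by simp
      also have "\<dots> = c * Poly_Mapping.lookup f D"
        using lookup_tl_mult_right[OF f g_TL, of D] by (simp add: c_def)
      finally show ?thesis .
    qed
    have "c \<noteq> 0"
    proof
      assume "c = 0"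
      then have "g = 0"
        by (intro poly_mapping_eqI) (simp add: g_f)
      with g show False by blast
    qed
    \<comment> \<open>Idempotency of \<open>g\<close>, read off at the identity diagram.\<close>
    have "c = c * c"
      using lookup_tl_mult_right[OF g_TL g_right g_TL, of "tl_id_diagram n"] unfolding gg c_def .
    with \<open>c \<noteq> 0\<close> have "c = 1"
      by simp
    then show "g = f"
      by (intro poly_mapping_eqI) (simp add: g_f)
  qed
qed

section \<open>Folding and cap insertion\<close>

fun shift_point :: "nat \<Rightarrow> tl_point \<Rightarrow> tl_point" where
  "shift_point i (Upper j) = Upper j"
| "shift_point i (Lower j) = Lower (if i \<le> j then j + 2 else j)"

text \<open>An involution rather than the one-way replacement used by \<open>fold_down\<close>: the
  two agree on diagrams with \<open>n + 1\<close> points on each edge, where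
  \<open>Lower (n + 2)\<close> does not occur, and the same map also unfolds.\<close>

definition fold_point :: "nat \<Rightarrow> tl_point \<Rightarrow> tl_point" where
  "fold_point n p = (if p = Upper (n + 1) then Lower (n + 2)
     else if p = Lower (n + 2) then Upper (n + 1) else p)"

text \<open>The inverse of the passage from \<open>D\<close> to \<open>D_i\<close>: open a gap at
  \<open>i\<close>, put a cap there, and unfold the last lower point.\<close>

definition insert_cap :: "nat \<Rightarrow> nat \<Rightarrow> diagram \<Rightarrow> diagram" where
  "insert_cap n i A = (`) (fold_point n) `
     insert {Lower i, Lower (i + 1)} ((`) (shift_point i) ` A)"

section \<open>Shifting and folding as bijections of marked points\<close>

lemma fold_point_fold_point [simp]: "fold_point n (fold_point n p) = p"
  by (simp add: fold_point_def)

lemma inj_fold_point: "inj (fold_point n)"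
  by (metis fold_point_fold_point injI)

lemma renumber_shift_point [simp]: "renumber i (shift_point i p) = p"
  by (cases p) auto

lemma inj_shift_point: "inj (shift_point i)"
  by (metis renumber_shift_point injI)

lemma shift_point_renumber:
  assumes "p \<noteq> Lower i" "p \<noteq> Lower (i + 1)"
  shows "shift_point i (renumber i p) = p"
  using assms by (cases p) auto

lemma shift_point_neq: "shift_point i p \<noteq> Lower i" "shift_point i p \<noteq> Lower (Suc i)"
  by (cases p; auto)+

lemma shift_point_Suc: "p \<noteq> Lower i \<Longrightarrow> shift_point (Suc i) p = shift_point i p"
  by (cases p) auto

lemma fold_point_image_tl_points: "fold_point n ` tl_points (n + 1) (n + 1) = tl_points n (n + 2)"
proof (rule set_eqI)
  fix p
  have "p \<in> fold_point n ` tl_points (n + 1) (n + 1) \<longleftrightarrow> fold_point n p \<in> tl_points (n + 1) (n + 1)"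
    using inj_image_mem_iff[OF inj_fold_point, of n "fold_point n p" "tl_points (n + 1) (n + 1)"] by simp
  also have "\<dots> \<longleftrightarrow> p \<in> tl_points n (n + 2)"
    by (cases p) (auto simp: fold_point_def)
  finally show "p \<in> fold_point n ` tl_points (n + 1) (n + 1) \<longleftrightarrow> p \<in> tl_points n (n + 2)" .
qed

lemma shift_point_image_tl_points:
  assumes "1 \<le> i" "i \<le> n + 1"
  shows "shift_point i ` tl_points n n = tl_points n (n + 2) - {Lower i, Lower (i + 1)}"
proof
  show "shift_point i ` tl_points n n \<subseteq> tl_points n (n + 2) - {Lower i, Lower (i + 1)}"
    by (auto simp: tl_points_def split: if_splits)
  show "tl_points n (n + 2) - {Lower i, Lower (i + 1)} \<subseteq> shift_point i ` tl_points n n"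
  proof
    fix p
    assume p: "p \<in> tl_points n (n + 2) - {Lower i, Lower (i + 1)}"
    then have "p = shift_point i (renumber i p)"
      by (simp add: shift_point_renumber)
    moreover have "renumber i p \<in> tl_points n n"
      using p assms by (cases p) auto
    ultimately show "p \<in> shift_point i ` tl_points n n"
      by (rule image_eqI)
  qed
qed

lemma doubleton_mem_image:
  assumes "inj f"
  shows "{f x, f y} \<in> (`) f ` A \<longleftrightarrow> {x, y} \<in> A"
proof -
  have "{f x, f y} = f ` {x, y}"
    by simp
  moreover have "inj ((`) f)"
    using assms by (metis inj_image_eq_iff injI)
  ultimately show ?thesis
    by (metis inj_image_mem_iff)
qed

lemma partition_on_image_inj:
  assumes "partition_on V A" "inj_on f V"
  shows "partition_on (f ` V) ((`) f ` A)"
proof -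
  have "{} \<notin> (`) f ` A"
    using partition_onD3[OF assms(1)] by auto
  then show ?thesis
    using partition_on_inj_image[OF assms] by simp
qed

section \<open>Planarity under shifting, cap insertion and folding\<close>

lemma noncrossingD:
  assumes "noncrossing D" "{a, b} \<in> D" "{c, d} \<in> D" "boundary_pos a < boundary_pos c"
    "boundary_pos c < boundary_pos b" "boundary_pos b < boundary_pos d"
  shows False
  using assms unfolding noncrossing_def by blast

lemma noncrossingI:
  assumes "\<And>a b c d. {a, b} \<in> D \<Longrightarrow> {c, d} \<in> D \<Longrightarrow> boundary_pos a < boundary_pos c \<Longrightarrow>
    boundary_pos c < boundary_pos b \<Longrightarrow> boundary_pos b < boundary_pos d \<Longrightarrow> False"
  shows "noncrossing D"
  using assms unfolding noncrossing_def by blast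

lemma noncrossing_subset: "noncrossing D \<Longrightarrow> E \<subseteq> D \<Longrightarrow> noncrossing E"
  unfolding noncrossing_def by blast

text \<open>Opening a gap keeps the boundary order. For \<open>i = 0\<close> the point
  \<open>Lower 0\<close> would move away from \<open>Upper 0\<close>, with which it shares the
  boundary position 0.\<close>

lemma boundary_pos_shift_point:
  assumes "1 \<le> i"
  shows "boundary_pos (shift_point i p) < boundary_pos (shift_point i q) \<longleftrightarrow> boundary_pos p < boundary_pos q"
  using assms by (cases p; cases q) auto

lemma noncrossing_shift_point:
  assumes "1 \<le> i"
  shows "noncrossing ((`) (shift_point i) ` A) \<longleftrightarrow> noncrossing A"
proof
  assume nc: "noncrossing ((`) (shift_point i) ` A)"
  show "noncrossing A"
  proof (rule noncrossingI)
    fix a b c d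
    assume "{a, b} \<in> A" "{c, d} \<in> A" "boundary_pos a < boundary_pos c"
      "boundary_pos c < boundary_pos b" "boundary_pos b < boundary_pos d"
    then show False
      using noncrossingD[OF nc, of "shift_point i a" "shift_point i b" "shift_point i c" "shift_point i d"]
      by (simp add: doubleton_mem_image[OF inj_shift_point] boundary_pos_shift_point[OF assms])
  qed
next
  assume nc: "noncrossing A"
  show "noncrossing ((`) (shift_point i) ` A)"
  proof (rule noncrossingI)
    fix a b c d
    assume *: "{a, b} \<in> (`) (shift_point i) ` A" "{c, d} \<in> (`) (shift_point i) ` A"
      and pos: "boundary_pos a < boundary_pos c" "boundary_pos c < boundary_pos b"
        "boundary_pos b < boundary_pos d"
    from * have "\<exists>x. a = shift_point i x" "\<exists>x. b = shift_point i x"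
      "\<exists>x. c = shift_point i x" "\<exists>x. d = shift_point i x"
      by blast+
    then obtain a' b' c' d' where eq: "a = shift_point i a'" "b = shift_point i b'"
      "c = shift_point i c'" "d = shift_point i d'"
      by blast
    show False
      using noncrossingD[OF nc, of a' b' c' d'] * pos unfolding eq
      by (simp add: doubleton_mem_image[OF inj_shift_point] boundary_pos_shift_point[OF assms])
  qed
qed

text \<open>No integer lies strictly between the boundary positions of two adjacent lower points, so
  no arc can interleave with the cap.\<close>

lemma noncrossing_insert_cap:
  assumes "noncrossing A"
  shows "noncrossing (insert {Lower i, Lower (i + 1)} A)"
proof (rule noncrossingI)
  fix a b c d
  assume *: "{a, b} \<in> insert {Lower i, Lower (i + 1)} A" "{c, d} \<in> insert {Lower i, Lower (i + 1)} A"
    and pos: "boundary_pos a < boundary_pos c" "boundary_pos c < boundary_pos b"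
      "boundary_pos b < boundary_pos d"
  have adj: False if "{u, v} = {Lower i, Lower (i + 1)}" "boundary_pos u < k" "k < boundary_pos v" for u v k
    using that by (auto simp: doubleton_eq_iff)
  have "{a, b} \<in> A"
    using *(1) adj[of a b] pos by blast
  moreover have "{c, d} \<in> A"
    using *(2) adj[of c d] pos by blast
  ultimately show False
    using noncrossingD[OF assms] pos by blast
qed

text \<open>
  Folding moves one point from the last to the first place of the boundary order, so a pattern of
  interleaved end points is only rotated.
\<close>

lemma noncrossing_fold_point:
  assumes nc: "noncrossing D" and D: "\<Union> D = tl_points (n + 1) (n + 1)"
  shows "noncrossing ((`) (fold_point n) ` D)"
proof (rule noncrossingI)
  fix a b c d
  assume "{a, b} \<in> (`) (fold_point n) ` D" "{c, d} \<in> (`) (fold_point n) ` D"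
    and pos: "boundary_pos a < boundary_pos c" "boundary_pos c < boundary_pos b"
      "boundary_pos b < boundary_pos d"
  then have arcs: "{fold_point n a, fold_point n b} \<in> D" "{fold_point n c, fold_point n d} \<in> D"
    using doubleton_mem_image[OF inj_fold_point, of n "fold_point n _" "fold_point n _" D]
    by (metis fold_point_fold_point)+
  then have "fold_point n x \<in> tl_points (n + 1) (n + 1)" if "x \<in> {a, b, c, d}" for x
    using that unfolding D[symmetric] by blast
  then have pts: "x \<in> tl_points n (n + 2)" if "x \<in> {a, b, c, d}" for x
    using that fold_point_image_tl_points[of n] by (metis fold_point_fold_point imageI)
  have fixed: "fold_point n x = x" if "x \<in> {a, b, c, d}" "x \<noteq> Lower (n + 2)" for x
    using pts[OF that(1)] that(2) by (auto simp: fold_point_def)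
  have bounds: "- int (n + 2) \<le> boundary_pos x" "boundary_pos x < int (n + 1)" if "x \<in> {a, b, c, d}" for x
    using pts[OF that] by (cases x; auto)+
  \<comment> \<open>The point moved by folding is the first one in the boundary order, so only
    \<open>a\<close>, the least of the four, can be that point.\<close>
  have "b \<noteq> Lower (n + 2)" "c \<noteq> Lower (n + 2)" "d \<noteq> Lower (n + 2)"
    using pos bounds(1)[of a] by auto
  then have bcd: "fold_point n b = b" "fold_point n c = c" "fold_point n d = d"
    using fixed by blast+
  show False
  proof (cases "a = Lower (n + 2)")
    case True
    then have "fold_point n a = Upper (n + 1)"
      by (simp add: fold_point_def)
    then have "{b, Upper (n + 1)} \<in> D" "{c, d} \<in> D"
      using arcs by (simp_all add: bcd insert_commute)
    then show False
      using noncrossingD[OF nc, of c d b "Upper (n + 1)"] pos bounds(2)[of d] by simp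
  next
    case False
    then have "fold_point n a = a"
      using fixed by blast
    then show False
      using noncrossingD[OF nc, of a b c d] arcs pos by (simp add: bcd)
  qed
qed

text \<open>The opposite rotation: the moved point is now the last one in the boundary order, so
  only \<open>d\<close> is affected.\<close>

lemma noncrossing_unfold_point:
  assumes nc: "noncrossing D" and D: "\<Union> D = tl_points n (n + 2)"
  shows "noncrossing ((`) (fold_point n) ` D)"
proof (rule noncrossingI)
  fix a b c d
  assume "{a, b} \<in> (`) (fold_point n) ` D" "{c, d} \<in> (`) (fold_point n) ` D"
    and pos: "boundary_pos a < boundary_pos c" "boundary_pos c < boundary_pos b"
      "boundary_pos b < boundary_pos d"
  then have arcs: "{fold_point n a, fold_point n b} \<in> D" "{fold_point n c, fold_point n d} \<in> D"
    using doubleton_mem_image[OF inj_fold_point, of n "fold_point n _" "fold_point n _" D]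
    by (metis fold_point_fold_point)+
  then have "fold_point n x \<in> tl_points n (n + 2)" if "x \<in> {a, b, c, d}" for x
    using that unfolding D[symmetric] by blast
  then have pts: "x \<in> tl_points (n + 1) (n + 1)" if "x \<in> {a, b, c, d}" for x
    using that fold_point_image_tl_points[of n] inj_image_mem_iff[OF inj_fold_point] by metis
  have fixed: "fold_point n x = x" if "x \<in> {a, b, c, d}" "x \<noteq> Upper (n + 1)" for x
    using pts[OF that(1)] that(2) by (auto simp: fold_point_def)
  have bounds: "- int (n + 2) < boundary_pos x" "boundary_pos x \<le> int (n + 1)" if "x \<in> {a, b, c, d}" for x
    using pts[OF that] by (cases x; auto)+
  have "a \<noteq> Upper (n + 1)" "b \<noteq> Upper (n + 1)" "c \<noteq> Upper (n + 1)"
    using pos bounds(2)[of d] by auto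
  then have abc: "fold_point n a = a" "fold_point n b = b" "fold_point n c = c"
    using fixed by blast+
  show False
  proof (cases "d = Upper (n + 1)")
    case True
    then have "fold_point n d = Lower (n + 2)"
      by (simp add: fold_point_def)
    then have "{Lower (n + 2), c} \<in> D" "{a, b} \<in> D"
      using arcs by (simp_all add: abc insert_commute)
    then show False
      using noncrossingD[OF nc, of "Lower (n + 2)" c a b] pos bounds(1)[of a] by simp
  next
    case False
    then have "fold_point n d = d"
      using fixed by blast
    then show False
      using noncrossingD[OF nc, of a b c d] arcs pos by (simp add: abc)
  qed
qed

lemma card_2_image_inj:
  assumes "inj f" "\<And>a. a \<in> A \<Longrightarrow> card a = 2" "b \<in> (`) f ` A"
  shows "card b = 2"
  using assms card_image[OF inj_on_subset[OF assms(1) subset_UNIV]] by auto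

lemma fold_point_tl_diagrams:
  assumes D: "D \<in> tl_diagrams (n + 1) (n + 1)"
  shows "(`) (fold_point n) ` D \<in> tl_diagrams n (n + 2)"
  unfolding tl_diagrams_def
proof (intro CollectI conjI ballI)
  show "partition_on (tl_points n (n + 2)) ((`) (fold_point n) ` D)"
    using partition_on_image_inj[OF tl_diagramsD(6)[OF D] inj_on_subset[OF inj_fold_point[of n] subset_UNIV]]
    unfolding fold_point_image_tl_points .
  show "noncrossing ((`) (fold_point n) ` D)"
    using noncrossing_fold_point tl_diagramsD[OF D] by blast
  show "card a = 2" if "a \<in> (`) (fold_point n) ` D" for a
    using tl_diagramsD(3)[OF D] that by (rule card_2_image_inj[OF inj_fold_point])
qed

lemma unfold_point_tl_diagrams:
  assumes D: "D \<in> tl_diagrams n (n + 2)"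
  shows "(`) (fold_point n) ` D \<in> tl_diagrams (n + 1) (n + 1)"
  unfolding tl_diagrams_def
proof (intro CollectI conjI ballI)
  have "fold_point n ` tl_points n (n + 2) = tl_points (n + 1) (n + 1)"
    unfolding fold_point_image_tl_points[symmetric] image_image by simp
  then show "partition_on (tl_points (n + 1) (n + 1)) ((`) (fold_point n) ` D)"
    using partition_on_image_inj[OF tl_diagramsD(6)[OF D] inj_on_subset[OF inj_fold_point subset_UNIV], of n]
    by simp
  show "noncrossing ((`) (fold_point n) ` D)"
    using noncrossing_unfold_point tl_diagramsD[OF D] by blast
  show "card a = 2" if "a \<in> (`) (fold_point n) ` D" for a
    using tl_diagramsD(3)[OF D] that by (rule card_2_image_inj[OF inj_fold_point])
qed

lemma cap_not_in_shift_point: "{Lower i, Lower (i + 1)} \<notin> (`) (shift_point i) ` A"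
proof
  assume "{Lower i, Lower (i + 1)} \<in> (`) (shift_point i) ` A"
  then have "Lower i \<in> range (shift_point i)" by blast
  then show False using shift_point_neq by (metis imageE)
qed

lemma insert_cap_tl_diagrams:
  assumes A: "A \<in> tl_diagrams n n" and i: "1 \<le> i" "i \<le> n + 1"
  shows "insert_cap n i A \<in> tl_diagrams (n + 1) (n + 1)"
  unfolding insert_cap_def
proof (rule unfold_point_tl_diagrams)
  let ?c = "{Lower i, Lower (i + 1)}" and ?B = "(`) (shift_point i) ` A"
  have B: "partition_on (tl_points n (n + 2) - ?c) ?B"
    using partition_on_image_inj[OF tl_diagramsD(6)[OF A] inj_on_subset[OF inj_shift_point subset_UNIV], of i]
    unfolding shift_point_image_tl_points[OF i] .
  have "disjnt ?c (\<Union> ?B)"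
    unfolding partition_onD1[OF B, symmetric] by (auto simp: disjnt_def)
  then have "partition_on (tl_points n (n + 2)) (insert ?c ?B)"
    using B i by (subst partition_on_insert) auto
  moreover have "noncrossing (insert ?c ?B)"
    using tl_diagramsD(4)[OF A] noncrossing_shift_point[OF i(1)] noncrossing_insert_cap by blast
  moreover have "card a = 2" if "a \<in> insert ?c ?B" for a
    using that card_2_image_inj[where b = a, OF inj_shift_point[of i] tl_diagramsD(3)[OF A]] by auto
  ultimately show "insert ?c ?B \<in> tl_diagrams n (n + 2)"
    by (simp add: tl_diagrams_def)
qed

section \<open>Inserting and removing a cap as inverse maps\<close>

lemma fold_down_eq:
  assumes "D \<in> tl_diagrams (n + 1) (n + 1)"
  shows "fold_down n D = (`) (fold_point n) ` D"
  unfolding fold_down_def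
proof (rule image_cong[OF refl])
  fix a
  assume "a \<in> D"
  then have "a \<subseteq> tl_points (n + 1) (n + 1)"
    using tl_diagramsD(1)[OF assms] by blast
  then have "(if p = Upper (n + 1) then Lower (n + 2) else p) = fold_point n p" if "p \<in> a" for p
    using that by (auto simp: fold_point_def)
  then show "(\<lambda>p. if p = Upper (n + 1) then Lower (n + 2) else p) ` a = fold_point n ` a"
    by (intro image_cong) simp_all
qed

lemma image_fold_point_fold_point: "(`) (fold_point n) ` (`) (fold_point n) ` D = D"
  by (simp add: image_image)

lemma fold_down_insert_cap:
  assumes "A \<in> tl_diagrams n n" "1 \<le> i" "i \<le> n + 1"
  shows "fold_down n (insert_cap n i A) = insert {Lower i, Lower (i + 1)} ((`) (shift_point i) ` A)"
  unfolding fold_down_eq[OF insert_cap_tl_diagrams[OF assms]]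
  unfolding insert_cap_def image_fold_point_fold_point ..

lemma remove_cap_insert_cap:
  assumes "A \<in> tl_diagrams n n" "1 \<le> i" "i \<le> n + 1"
  shows "remove_cap i (fold_down n (insert_cap n i A)) = A"
proof -
  have "insert {Lower i, Lower (i + 1)} ((`) (shift_point i) ` A) - {{Lower i, Lower (i + 1)}} =
      (`) (shift_point i) ` A"
    using cap_not_in_shift_point by blast
  then show ?thesis
    unfolding fold_down_insert_cap[OF assms] remove_cap_def by (simp add: image_image)
qed

text \<open>Together with \<open>remove_cap_insert_cap\<close>, this makes insertion at
  \<open>i\<close> a bijection from the diagrams of \<open>TL_n\<close> onto those diagrams of
  \<open>TL_(n+1)\<close> whose folding has an innermost cap at \<open>i\<close>.\<close>

lemma insert_cap_remove_cap:
  assumes D: "D \<in> tl_diagrams (n + 1) (n + 1)" and i: "i \<in> innermost_cap_positions (fold_down n D)"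
  shows "1 \<le> i" "i \<le> n + 1" "remove_cap i (fold_down n D) \<in> tl_diagrams n n"
    "insert_cap n i (remove_cap i (fold_down n D)) = D"
proof -
  define E where "E = fold_down n D"
  have E_eq: "E = (`) (fold_point n) ` D"
    unfolding E_def using D by (rule fold_down_eq)
  have E: "E \<in> tl_diagrams n (n + 2)"
    unfolding E_eq using D by (rule fold_point_tl_diagrams)
  let ?c = "{Lower i, Lower (i + 1)}"
  have c: "?c \<in> E"
    using i by (simp add: innermost_cap_positions_def E_def)
  then have "Lower i \<in> tl_points n (n + 2)" "Lower (i + 1) \<in> tl_points n (n + 2)"
    using tl_diagramsD(1)[OF E] by blast+
  then show i': "1 \<le> i" "i \<le> n + 1"
    by simp_all
  have "disjnt ?c (\<Union> (E - {?c}))"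
    using tl_diagramsD(5)[OF E c] by (auto simp: disjnt_def)
  moreover have "partition_on (tl_points n (n + 2)) (insert ?c (E - {?c}))"
    using tl_diagramsD(6)[OF E] c by (simp add: insert_absorb)
  ultimately have part: "partition_on (tl_points n (n + 2) - ?c) (E - {?c})"
    using partition_on_insert by blast
  have unshift: "shift_point i (renumber i p) = p" if "p \<in> tl_points n (n + 2) - ?c" for p
    using that by (intro shift_point_renumber) auto
  define A where "A = remove_cap i E"
  have A_eq: "A = (`) (renumber i) ` (E - {?c})"
    by (simp add: A_def remove_cap_def)
  have "shift_point i ` renumber i ` a = a" if "a \<in> E - {?c}" for a
  proof -
    have "a \<subseteq> tl_points n (n + 2) - ?c"
      using that partition_onD1[OF part] by blast
    then show ?thesis
      using unshift by (force simp: image_image)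
  qed
  then have shift_A: "(`) (shift_point i) ` A = E - {?c}"
    unfolding A_eq by (simp add: image_image)
  show "remove_cap i (fold_down n D) \<in> tl_diagrams n n"
    unfolding E_def[symmetric] A_def[symmetric] tl_diagrams_def
  proof (intro CollectI conjI ballI)
    have inj: "inj_on (renumber i) (tl_points n (n + 2) - ?c)"
      using unshift by (rule inj_on_inverseI)
    have "renumber i ` (tl_points n (n + 2) - ?c) = tl_points n n"
      unfolding shift_point_image_tl_points[OF i', symmetric] image_image by simp
    then show "partition_on (tl_points n n) A"
      using partition_on_image_inj[OF part inj] by (simp add: A_eq)
    \<comment> \<open>Crossings are tested after reopening the gap, where the arcs form a subset of
      \<open>E\<close>.\<close>
    show "noncrossing A"
      unfolding noncrossing_shift_point[OF i'(1), of A, symmetric] shift_A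
      using tl_diagramsD(4)[OF E] by (rule noncrossing_subset) simp
    show "card a = 2" if "a \<in> A" for a
    proof -
      have "shift_point i ` a \<in> E"
        using that shift_A by blast
      then show ?thesis
        using tl_diagramsD(3)[OF E] card_image[OF inj_on_subset[OF inj_shift_point subset_UNIV]] by metis
    qed
  qed
  show "insert_cap n i (remove_cap i (fold_down n D)) = D"
    unfolding E_def[symmetric] A_def[symmetric] insert_cap_def shift_A
    using c by (simp only: insert_Diff E_eq image_fold_point_fold_point)
qed

section \<open>The recursion\<close>

lemma cap_off_disjoint_arcs:
  assumes "x \<notin> \<Union> A" "y \<notin> \<Union> A" "p \<notin> {x, y}" "p' \<notin> {x, y}" "x \<noteq> y"
  shows "cap_off x y (insert {x, p} (insert {y, p'} A)) = insert {x, y} (insert {p, p'} A)"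
proof -
  let ?B = "insert {x, p} (insert {y, p'} A)"
  have "{a \<in> ?B. x \<in> a \<or> y \<in> a} = {{x, p}, {y, p'}}"
    using assms by blast
  then have "\<Union> {a \<in> ?B. x \<in> a \<or> y \<in> a} - {x, y} = {p, p'}"
    using assms by auto
  moreover have "{a \<in> ?B. x \<notin> a \<and> y \<notin> a} = A"
    using assms by blast
  ultimately show ?thesis
    unfolding cap_off_def by auto
qed

section \<open>Generators acting below an inserted cap\<close>

definition cap_point :: "nat \<Rightarrow> nat \<Rightarrow> tl_point \<Rightarrow> tl_point" where
  "cap_point n i p = fold_point n (shift_point i p)"

lemma inj_cap_point: "inj (cap_point n i)"
  unfolding cap_point_def using inj_compose[OF inj_fold_point inj_shift_point] by (simp add: comp_def)

lemma insert_cap_eq: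
  "insert_cap n i A = insert {fold_point n (Lower i), fold_point n (Lower (i + 1))} ((`) (cap_point n i) ` A)"
  by (simp add: insert_cap_def image_image cap_point_def)

lemma fold_point_Lower: "j \<noteq> n + 2 \<Longrightarrow> fold_point n (Lower j) = Lower j"
  by (simp add: fold_point_def)

lemma cap_point_not_cap: "cap_point n i p \<noteq> fold_point n (Lower i)" "cap_point n i p \<noteq> fold_point n (Lower (i + 1))"
  using shift_point_neq[of i p] inj_fold_point[of n] by (auto simp: cap_point_def inj_eq)

text \<open>The generator misses the inserted cap and therefore acts as \<open>e_k\<close> on
  \<open>A\<close>. The two hypotheses \<open>far\<close> treat both sides at once: \<open>k\<close>
  is \<open>j\<close> when the cap lies to the right of the strands and \<open>j - 2\<close> when it
  lies to the left.\<close>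

lemma insert_cap_gen_far:
  assumes A: "A \<in> tl_diagrams n n" and i: "1 \<le> i" "i \<le> n + 1" and j: "1 \<le> j" "j \<le> n"
    and k: "1 \<le> k" "k < n"
    and far: "Lower j = cap_point n i (Lower k)" "Lower (j + 1) = cap_point n i (Lower (k + 1))"
  shows "stack (insert_cap n i A) (tl_gen_diagram (n + 1) j) = insert_cap n i (stack A (tl_gen_diagram n k))"
    and "loops (insert_cap n i A) (tl_gen_diagram (n + 1) j) = loops A (tl_gen_diagram n k)"
proof -
  let ?c = "{fold_point n (Lower i), fold_point n (Lower (i + 1))}"
  have j': "j < n + 1" using j by simp
  have out: "Lower j \<notin> ?c" "Lower (j + 1) \<notin> ?c"
    unfolding far using cap_point_not_cap[of n i] by blast+
  note gen = stack_gen_right[OF insert_cap_tl_diagrams[OF A i] j(1) j'] stack_gen_right[OF A k]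
  show "stack (insert_cap n i A) (tl_gen_diagram (n + 1) j) = insert_cap n i (stack A (tl_gen_diagram n k))"
    unfolding gen
    unfolding insert_cap_eq cap_off_insert[OF out]
    unfolding far cap_off_image[OF inj_cap_point] ..
  have "{Lower j, Lower (j + 1)} \<noteq> ?c"
    using out by blast
  then have "{Lower j, Lower (j + 1)} \<in> insert_cap n i A \<longleftrightarrow> {Lower k, Lower (k + 1)} \<in> A"
    unfolding insert_cap_eq far using doubleton_mem_image[OF inj_cap_point] by blast
  then show "loops (insert_cap n i A) (tl_gen_diagram (n + 1) j) = loops A (tl_gen_diagram n k)"
    unfolding gen by simp
qed

text \<open>The inserted cap and the cup of the generator close up to a loop, and the cap of the
  generator replaces the one lost.\<close>

lemma insert_cap_gen_same:
  assumes A: "A \<in> tl_diagrams n n" and j: "1 \<le> j" "j \<le> n"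
  shows "stack (insert_cap n j A) (tl_gen_diagram (n + 1) j) = insert_cap n j A"
    and "loops (insert_cap n j A) (tl_gen_diagram (n + 1) j) = 1"
proof -
  have T: "insert_cap n j A \<in> tl_diagrams (n + 1) (n + 1)"
    using A j by (intro insert_cap_tl_diagrams) simp_all
  have cap: "{Lower j, Lower (j + 1)} \<in> insert_cap n j A"
    using j by (simp add: insert_cap_eq fold_point_Lower)
  have "cap_off (Lower j) (Lower (j + 1)) (insert_cap n j A) = insert_cap n j A"
  proof (rule cap_off_arc[OF _ cap])
    show "a = {Lower j, Lower (j + 1)}" if "a \<in> insert_cap n j A" "Lower j \<in> a \<or> Lower (j + 1) \<in> a" for a
      using tl_diagramsD(5)[OF T that(1) cap] that(2) by blast
  qed
  then show "stack (insert_cap n j A) (tl_gen_diagram (n + 1) j) = insert_cap n j A"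
    "loops (insert_cap n j A) (tl_gen_diagram (n + 1) j) = 1"
    using stack_gen_right[OF T j(1)] j cap by simp_all
qed

lemma cap_point_Suc: "p \<noteq> Lower i \<Longrightarrow> cap_point n (Suc i) p = cap_point n i p"
  by (simp add: cap_point_def shift_point_Suc)

text \<open>
  The strand of \<open>A\<close> that ends at \<open>Lower i\<close> is the one that a cap passes when it slides from
  position \<open>i\<close> to \<open>i + 1\<close>; all other arcs of the two diagrams agree.
\<close>

lemma insert_cap_split:
  assumes A: "A \<in> tl_diagrams n n" and i: "1 \<le> i" "i \<le> n"
  obtains p A0 where "p \<noteq> Lower i"
    "insert_cap n i A = insert {fold_point n (Lower (i + 2)), cap_point n i p}
       (insert {Lower i, Lower (i + 1)} A0)"
    "insert_cap n (i + 1) A = insert {Lower i, cap_point n i p}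
       (insert {Lower (i + 1), fold_point n (Lower (i + 2))} A0)"
    "Lower i \<notin> \<Union> A0" "Lower (i + 1) \<notin> \<Union> A0" "fold_point n (Lower (i + 2)) \<notin> \<Union> A0"
proof -
  note AD = tl_diagramsD[OF A]
  have "Lower i \<in> tl_points n n"
    using i by simp
  then obtain p where p: "{Lower i, p} \<in> A" "Lower i \<noteq> p"
    by (rule tl_diagrams_arc[OF A])
  define B where "B = A - {{Lower i, p}}"
  have A_eq: "A = insert {Lower i, p} B"
    using p(1) by (auto simp: B_def)
  have B: "Lower i \<notin> \<Union> B"
  proof
    assume "Lower i \<in> \<Union> B"
    then obtain a where "a \<in> A" "a \<noteq> {Lower i, p}" "Lower i \<in> a"
      by (auto simp: B_def)
    then show False
      using AD(5)[of a "{Lower i, p}" "Lower i"] p(1) by simp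
  qed
  define A0 where "A0 = (`) (cap_point n i) ` B"
  have "cap_point n (i + 1) ` a = cap_point n i ` a" if "a \<in> B" for a
  proof (rule image_cong[OF refl])
    fix q
    assume "q \<in> a"
    then have "q \<noteq> Lower i"
      using that B by blast
    then show "cap_point n (i + 1) q = cap_point n i q"
      by (simp add: cap_point_Suc)
  qed
  then have A0: "(`) (cap_point n (i + 1)) ` B = A0"
    by (simp add: A0_def)
  \<comment> \<open>For \<open>i = n\<close> the point \<open>Lower (i + 2)\<close> unfolds to
    \<open>Upper (n + 1)\<close>, so \<open>fold_point\<close> stays in place there;
    \<open>Lower i\<close> and \<open>Lower (i + 1)\<close> are always fixed.\<close>
  have caps: "cap_point n i (Lower i) = fold_point n (Lower (i + 2))" "cap_point n (i + 1) (Lower i) = Lower i"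
    "cap_point n (i + 1) p = cap_point n i p" "fold_point n (Lower i) = Lower i"
    "fold_point n (Lower (i + 1)) = Lower (i + 1)"
    using i p(2) by (simp_all add: cap_point_def fold_point_Lower shift_point_Suc)
  have mem: "cap_point n i x \<in> \<Union> A0 \<longleftrightarrow> x \<in> \<Union> B" for x
    unfolding A0_def image_Union[symmetric] by (rule inj_image_mem_iff[OF inj_cap_point])
  show thesis
  proof (rule that)
    show "p \<noteq> Lower i" using p(2) by simp
    show "insert_cap n i A = insert {fold_point n (Lower (i + 2)), cap_point n i p}
        (insert {Lower i, Lower (i + 1)} A0)"
      unfolding insert_cap_eq A_eq image_insert image_empty caps A0_def[symmetric] by (rule insert_commute)
    show "insert_cap n (i + 1) A = insert {Lower i, cap_point n i p}
        (insert {Lower (i + 1), fold_point n (Lower (i + 2))} A0)"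
      unfolding insert_cap_eq A_eq image_insert image_empty caps A0
      by (simp add: caps insert_commute)
    show "Lower i \<notin> \<Union> A0" "Lower (i + 1) \<notin> \<Union> A0"
      using cap_point_not_cap[of n i] unfolding caps A0_def by auto metis+
    show "fold_point n (Lower (i + 2)) \<notin> \<Union> A0"
      using mem[of "Lower i"] B unfolding caps by simp
  qed
qed

text \<open>A zigzag straightens: the strand ending at \<open>j\<close> continues through the cup of
  the generator and the inserted cap to position \<open>j + 2\<close>, while the cap of the
  generator appears at \<open>j\<close>. For \<open>j = n\<close> the strand ends at
  \<open>Upper (n + 1)\<close>.\<close>

lemma insert_cap_gen_left:
  assumes A: "A \<in> tl_diagrams n n" and j: "1 \<le> j" "j \<le> n"
  shows "stack (insert_cap n (j + 1) A) (tl_gen_diagram (n + 1) j) = insert_cap n j A"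
    and "loops (insert_cap n (j + 1) A) (tl_gen_diagram (n + 1) j) = 0"
proof -
  obtain p A0 where p: "p \<noteq> Lower j"
    and T: "insert_cap n j A = insert {fold_point n (Lower (j + 2)), cap_point n j p}
       (insert {Lower j, Lower (j + 1)} A0)"
    "insert_cap n (j + 1) A = insert {Lower j, cap_point n j p}
       (insert {Lower (j + 1), fold_point n (Lower (j + 2))} A0)"
    and A0: "Lower j \<notin> \<Union> A0" "Lower (j + 1) \<notin> \<Union> A0" "fold_point n (Lower (j + 2)) \<notin> \<Union> A0"
    by (rule insert_cap_split[OF A j])
  have T': "insert_cap n (j + 1) A \<in> tl_diagrams (n + 1) (n + 1)"
    using A j by (intro insert_cap_tl_diagrams) simp_all
  have ne: "cap_point n j p \<notin> {Lower j, Lower (j + 1)}"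
    using cap_point_not_cap[of n j p] j by (simp add: fold_point_Lower)
  have ne': "fold_point n (Lower (j + 2)) \<notin> {Lower j, Lower (j + 1)}"
    by (auto simp: fold_point_def)
  note gen = stack_gen_right[OF T' j(1)]
  show "stack (insert_cap n (j + 1) A) (tl_gen_diagram (n + 1) j) = insert_cap n j A"
    using gen(1) j cap_off_disjoint_arcs[OF A0(1,2) ne ne'] unfolding T by (simp add: insert_commute)
  have "{Lower j, Lower (j + 1)} \<notin> insert_cap n (j + 1) A"
    unfolding T(2) using A0(1) ne ne' by (auto simp: doubleton_eq_iff)
  then show "loops (insert_cap n (j + 1) A) (tl_gen_diagram (n + 1) j) = 0"
    using gen(2) j by simp
qed

text \<open>The mirror zigzag: the strand that ends at \<open>j + 2\<close>, to the right of the
  cap, is led back to position \<open>j\<close>.\<close>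

lemma insert_cap_gen_right:
  assumes A: "A \<in> tl_diagrams n n" and j: "1 \<le> j" "j + 1 \<le> n"
  shows "stack (insert_cap n j A) (tl_gen_diagram (n + 1) (j + 1)) = insert_cap n (j + 1) A"
    and "loops (insert_cap n j A) (tl_gen_diagram (n + 1) (j + 1)) = 0"
proof -
  have j': "j \<le> n" using j by simp
  obtain p A0 where p: "p \<noteq> Lower j"
    and T: "insert_cap n j A = insert {fold_point n (Lower (j + 2)), cap_point n j p}
       (insert {Lower j, Lower (j + 1)} A0)"
    "insert_cap n (j + 1) A = insert {Lower j, cap_point n j p}
       (insert {Lower (j + 1), fold_point n (Lower (j + 2))} A0)"
    and A0: "Lower j \<notin> \<Union> A0" "Lower (j + 1) \<notin> \<Union> A0" "fold_point n (Lower (j + 2)) \<notin> \<Union> A0"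
    by (rule insert_cap_split[OF A j(1) j'])
  have T': "insert_cap n j A \<in> tl_diagrams (n + 1) (n + 1)"
    using A j by (intro insert_cap_tl_diagrams) simp_all
  \<comment> \<open>Here \<open>j + 2\<close> is at most \<open>n + 1\<close>, so this end of the
    strand really is a lower point and is not unfolded.\<close>
  have fold: "fold_point n (Lower (j + 2)) = Lower (j + 2)"
    using j by (intro fold_point_Lower) simp
  have "cap_point n j p \<noteq> cap_point n j (Lower j)"
    using p inj_cap_point[of n j] by (auto simp: inj_eq)
  moreover have "cap_point n j (Lower j) = Lower (j + 2)"
    using fold by (simp add: cap_point_def)
  ultimately have ne: "cap_point n j p \<notin> {Lower (j + 1), Lower (j + 2)}" "cap_point n j p \<noteq> Lower j"
    using cap_point_not_cap[of n j p] j by (simp_all add: fold_point_Lower)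
  have j2: "1 \<le> j + 1" "j + 1 < n + 1" "j + 1 + 1 = j + 2" using j by simp_all
  note gen = stack_gen_right[OF T' j2(1,2), unfolded j2(3)]
  have "cap_off (Lower (j + 1)) (Lower (j + 2))
      (insert {Lower (j + 1), Lower j} (insert {Lower (j + 2), cap_point n j p} A0)) =
    insert {Lower (j + 1), Lower (j + 2)} (insert {Lower j, cap_point n j p} A0)"
    using A0(2,3)[unfolded fold] ne by (intro cap_off_disjoint_arcs) simp_all
  then show "stack (insert_cap n j A) (tl_gen_diagram (n + 1) (j + 1)) = insert_cap n (j + 1) A"
    unfolding gen(1) unfolding T fold by (simp add: insert_commute)
  have "{Lower (j + 1), Lower (j + 2)} \<notin> insert_cap n j A"
    unfolding T(1) fold using A0(2)[unfolded fold] ne by (auto simp: doubleton_eq_iff)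
  then show "loops (insert_cap n j A) (tl_gen_diagram (n + 1) (j + 1)) = 0"
    unfolding gen(2) by simp
qed

text \<open>The right-hand side of the recursion as an operator on elements. It sums over all
  positions; the restriction to innermost caps of a given \<open>D\<close> appears only when the
  coefficient of \<open>D\<close> is read off.\<close>

definition jw_step :: "nat \<Rightarrow> tl_element \<Rightarrow> tl_element" where
  "jw_step n f = (\<Sum>i = 1..n + 1. tl_lin (insert_cap n i) (\<lambda>_. qint i / qint (n + 1)) f)"

text \<open>Insertion at \<open>i\<close> is injective and \<open>D\<close> lies in its image
  exactly if its folding has a cap at \<open>i\<close>, so at most the one diagram
  \<open>D_i\<close> contributes.\<close>

lemma lookup_insert_cap:
  assumes f: "f \<in> TL n n" and D: "D \<in> tl_diagrams (n + 1) (n + 1)" and i: "1 \<le> i" "i \<le> n + 1"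
  shows "Poly_Mapping.lookup (tl_lin (insert_cap n i) (\<lambda>_. c) f) D =
    (if i \<in> innermost_cap_positions (fold_down n D)
     then c * Poly_Mapping.lookup f (remove_cap i (fold_down n D)) else 0)"
proof (cases "i \<in> innermost_cap_positions (fold_down n D)")
  case True
  let ?A = "remove_cap i (fold_down n D)"
  note A = insert_cap_remove_cap[OF D True]
  have "inj_on (insert_cap n i) (tl_diagrams n n)"
    by (rule inj_on_inverseI[where g = "\<lambda>D. remove_cap i (fold_down n D)"])
      (rule remove_cap_insert_cap[OF _ i])
  then have "inj_on (insert_cap n i) (insert ?A (Poly_Mapping.keys f))"
    by (rule inj_on_subset) (use f A(3) in \<open>auto simp: TL_def\<close>)
  from lookup_tl_lin_inj[OF this, where k = "\<lambda>_. c"] show ?thesis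
    using True by (simp add: A(4) mult.commute)
next
  case False
  have "D \<notin> insert_cap n i ` Poly_Mapping.keys f"
  proof
    assume "D \<in> insert_cap n i ` Poly_Mapping.keys f"
    then obtain A where "D = insert_cap n i A" "A \<in> tl_diagrams n n"
      using f by (auto simp: TL_def)
    then have "i \<in> innermost_cap_positions (fold_down n D)"
      using i by (simp add: fold_down_insert_cap innermost_cap_positions_def)
    then show False using False by simp
  qed
  then have "D \<notin> Poly_Mapping.keys (tl_lin (insert_cap n i) (\<lambda>_. c) f)"
    using keys_tl_lin by blast
  then show ?thesis
    using False by (simp add: in_keys_iff)
qed

lemma lookup_jw_step:
  assumes f: "f \<in> TL n n" and D: "D \<in> tl_diagrams (n + 1) (n + 1)"
  shows "Poly_Mapping.lookup (jw_step n f) D =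
    (\<Sum>i\<in>innermost_cap_positions (fold_down n D).
       qint i / qint (n + 1) * Poly_Mapping.lookup f (remove_cap i (fold_down n D)))"
proof -
  let ?I = "innermost_cap_positions (fold_down n D)"
  have I: "?I \<subseteq> {1..n + 1}"
    using insert_cap_remove_cap(1,2)[OF D] by auto
  have "Poly_Mapping.lookup (jw_step n f) D = (\<Sum>i = 1..n + 1. if i \<in> ?I
      then qint i / qint (n + 1) * Poly_Mapping.lookup f (remove_cap i (fold_down n D)) else 0)"
    unfolding jw_step_def lookup_sum
    by (intro sum.cong refl lookup_insert_cap[OF f D]) simp_all
  also have "\<dots> = (\<Sum>i\<in>?I. qint i / qint (n + 1) * Poly_Mapping.lookup f (remove_cap i (fold_down n D)))"
    using I by (intro sum.mono_neutral_cong_right) auto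
  finally show ?thesis .
qed

lemma jw_step_TL:
  assumes f: "f \<in> TL n n"
  shows "jw_step n f \<in> TL (n + 1) (n + 1)"
proof -
  have "D \<in> tl_diagrams (n + 1) (n + 1)" if "D \<in> Poly_Mapping.keys (jw_step n f)" for D
  proof -
    have "(\<Sum>i = 1..n + 1. Poly_Mapping.lookup
        (tl_lin (insert_cap n i) (\<lambda>_. qint i / qint (n + 1)) f) D) \<noteq> 0"
      using that unfolding in_keys_iff jw_step_def lookup_sum .
    then obtain i where i: "i \<in> {1..n + 1}"
      "D \<in> Poly_Mapping.keys (tl_lin (insert_cap n i) (\<lambda>_. qint i / qint (n + 1)) f)"
      unfolding in_keys_iff by (rule sum.not_neutral_contains_not_neutral)
    then obtain A where "A \<in> Poly_Mapping.keys f" "D = insert_cap n i A"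
      using keys_tl_lin by blast
    then show ?thesis
      using f i(1) insert_cap_tl_diagrams[of A n i] by (auto simp: TL_def)
  qed
  then show ?thesis
    by (auto simp: TL_def)
qed

text \<open>The generator can be moved past the insertion onto \<open>f\<close>, where it becomes
  \<open>e_k\<close> and gives zero.\<close>

lemma tl_lin_insert_cap_gen_far:
  assumes f: "f \<in> TL n n" "f \<circledast> tl_gen n k = 0"
    and i: "1 \<le> i" "i \<le> n + 1" and j: "1 \<le> j" "j \<le> n" and k: "1 \<le> k" "k < n"
    and far: "Lower j = cap_point n i (Lower k)" "Lower (j + 1) = cap_point n i (Lower (k + 1))"
  shows "tl_lin (insert_cap n i) (\<lambda>_. c) f \<circledast> tl_gen (n + 1) j = 0"
proof -
  have "tl_lin (insert_cap n i) (\<lambda>_. c) f \<circledast> tl_gen (n + 1) j =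
      tl_lin (\<lambda>A. insert_cap n i (stack A (tl_gen_diagram n k)))
        (\<lambda>A. (- qint 2) ^ loops A (tl_gen_diagram n k) * c) f"
    unfolding tl_gen_def tl_mult_single tl_lin_tl_lin
  proof (rule tl_lin_cong)
    fix A
    assume "A \<in> Poly_Mapping.keys f"
    then have A: "A \<in> tl_diagrams n n"
      using f(1) by (auto simp: TL_def)
    note gen = insert_cap_gen_far[OF A i j k far]
    show "stack (insert_cap n i A) (tl_gen_diagram (n + 1) j) = insert_cap n i (stack A (tl_gen_diagram n k))"
      by (rule gen(1))
    show "c * (- qint 2) ^ loops (insert_cap n i A) (tl_gen_diagram (n + 1) j) =
        (- qint 2) ^ loops A (tl_gen_diagram n k) * c"
      unfolding gen(2) by (rule mult.commute)
  qed
  also have "\<dots> = tl_lin (insert_cap n i) (\<lambda>_. c) (f \<circledast> tl_gen n k)"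
    unfolding tl_gen_def tl_mult_single tl_lin_tl_lin ..
  finally show ?thesis
    by (simp add: f(2))
qed

lemma tl_lin_insert_cap_gen_near:
  assumes f: "f \<in> TL n n"
    and gen: "\<And>A. A \<in> tl_diagrams n n \<Longrightarrow> stack (insert_cap n i A) (tl_gen_diagram (n + 1) j) = insert_cap n j A"
      "\<And>A. A \<in> tl_diagrams n n \<Longrightarrow> loops (insert_cap n i A) (tl_gen_diagram (n + 1) j) = l"
  shows "Poly_Mapping.lookup (tl_lin (insert_cap n i) (\<lambda>_. c) f \<circledast> tl_gen (n + 1) j) D =
    c * (- qint 2) ^ l * Poly_Mapping.lookup (tl_lin (insert_cap n j) (\<lambda>_. 1) f) D"
proof -
  have "tl_lin (insert_cap n i) (\<lambda>_. c) f \<circledast> tl_gen (n + 1) j =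
      tl_lin (insert_cap n j) (\<lambda>_. c * (- qint 2) ^ l * 1) f"
    unfolding tl_gen_def tl_mult_single tl_lin_tl_lin
    using f gen by (intro tl_lin_cong) (auto simp: TL_def subset_iff)
  then show ?thesis
    by (simp only: lookup_tl_lin_scale)
qed

lemma jw_step_gen_eq_0:
  assumes f: "f \<in> TL n n" "\<And>k. k \<in> {1..<n} \<Longrightarrow> f \<circledast> tl_gen n k = 0" and j: "1 \<le> j" "j \<le> n"
  shows "jw_step n f \<circledast> tl_gen (n + 1) j = 0"
proof (rule poly_mapping_eqI)
  fix D
  define t where "t i = Poly_Mapping.lookup
    (tl_lin (insert_cap n i) (\<lambda>_. qint i / qint (n + 1)) f \<circledast> tl_gen (n + 1) j) D" for i
  define L where "L = Poly_Mapping.lookup (tl_lin (insert_cap n j) (\<lambda>_. 1) f) D / qint (n + 1)"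
  have far: "t i = 0" if i: "1 \<le> i" "i \<le> n + 1" "i \<notin> {j - 1, j, j + 1}" for i
  proof (cases "i < j")
    case True
    \<comment> \<open>The cap lies to the left and occupies two lower points, so the strands at
      \<open>j\<close> and \<open>j + 1\<close> are those at \<open>j - 2\<close> and
      \<open>j - 1\<close> before insertion.\<close>
    have k: "1 \<le> j - 2" "j - 2 < n" "Suc (j - 2) = j - 1" "i \<le> j - 2"
      using True i j by auto
    have "Lower j = cap_point n i (Lower (j - 2))" "Lower (j + 1) = cap_point n i (Lower (j - 2 + 1))"
      using k j by (auto simp: cap_point_def fold_point_def)
    from tl_lin_insert_cap_gen_far[OF f(1) f(2) i(1,2) j k(1,2) this] k(1,2) show ?thesis
      by (simp add: t_def)
  next
    case False
    have k: "j < n" "j + 1 < i"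
      using False i by auto
    then have "Lower j = cap_point n i (Lower j)" "Lower (j + 1) = cap_point n i (Lower (j + 1))"
      by (auto simp: cap_point_def fold_point_def)
    from tl_lin_insert_cap_gen_far[OF f(1) f(2) i(1,2) j j(1) k(1) this] k(1) j show ?thesis
      by (simp add: t_def)
  qed
  have same: "t j = - (qint 2 * qint j) * L"
  proof -
    have "t j = qint j / qint (n + 1) * (- qint 2) ^ 1 *
        Poly_Mapping.lookup (tl_lin (insert_cap n j) (\<lambda>_. 1) f) D"
      unfolding t_def using insert_cap_gen_same[OF _ j] by (rule tl_lin_insert_cap_gen_near[OF f(1)])
    then show ?thesis
      by (simp add: L_def)
  qed
  have left: "t (j + 1) = qint (j + 1) * L"
  proof -
    have "t (j + 1) = qint (j + 1) / qint (n + 1) * (- qint 2) ^ 0 *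
        Poly_Mapping.lookup (tl_lin (insert_cap n j) (\<lambda>_. 1) f) D"
      unfolding t_def using insert_cap_gen_left[OF _ j] by (rule tl_lin_insert_cap_gen_near[OF f(1)])
    then show ?thesis
      by (simp add: L_def)
  qed
  have right: "t (j - 1) = qint (j - 1) * L" if "j \<noteq> 1"
  proof -
    have j': "1 \<le> j - 1" "j - 1 + 1 \<le> n" "j - 1 + 1 = j"
      using that j by simp_all
    have "t (j - 1) = qint (j - 1) / qint (n + 1) * (- qint 2) ^ 0 *
        Poly_Mapping.lookup (tl_lin (insert_cap n j) (\<lambda>_. 1) f) D"
      unfolding t_def using insert_cap_gen_right[OF _ j'(1,2), unfolded j'(3)]
      by (rule tl_lin_insert_cap_gen_near[OF f(1)])
    then show ?thesis
      by (simp add: L_def)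
  qed
  have "Poly_Mapping.lookup (jw_step n f \<circledast> tl_gen (n + 1) j) D = (\<Sum>i = 1..n + 1. t i)"
    unfolding jw_step_def tl_gen_def tl_mult_single tl_lin_sum lookup_sum t_def ..
  \<comment> \<open>For \<open>j = 1\<close> there is no left neighbour; the missing term agrees
    with the value \<open>[0] = 0\<close> in the three-term relation.\<close>
  also have "\<dots> = (\<Sum>i\<in>{j - 1, j, j + 1} - {0}. t i)"
  proof (rule sum.mono_neutral_right)
    show "\<forall>i\<in>{1..n + 1} - ({j - 1, j, j + 1} - {0}). t i = 0"
    proof
      fix i
      assume "i \<in> {1..n + 1} - ({j - 1, j, j + 1} - {0})"
      then show "t i = 0"
        by (intro far) auto
    qed
  qed (use j in auto)
  also have "\<dots> = (qint (j - 1) + qint (j + 1) - qint 2 * qint j) * L"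
  proof (cases "j = 1")
    case True
    then have "{j - 1, j, j + 1} - {0} = {j, j + 1}" by auto
    then show ?thesis
      using same left True by (simp add: qint_0 algebra_simps)
  next
    case False
    then have "{j - 1, j, j + 1} - {0} = {j - 1, j, j + 1}" "j - 1 \<noteq> j" "j - 1 \<noteq> j + 1"
      using j by auto
    then show ?thesis
      using right[OF False] same left by (simp add: algebra_simps)
  qed
  also have "qint (j - 1) + qint (j + 1) - qint 2 * qint j = 0"
    using qint_2_mult[of "j - 1"] j by simp
  finally show "Poly_Mapping.lookup (jw_step n f \<circledast> tl_gen (n + 1) j) D = Poly_Mapping.lookup 0 D"
    by simp
qed

text \<open>A cap at \<open>n + 1\<close> joins the last two lower points, and unfolding turns it
  into the last vertical strand.\<close>

lemma insert_cap_id_diagram: "insert_cap n (n + 1) (tl_id_diagram n) = tl_id_diagram (n + 1)"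
proof -
  have fold: "fold_point n (Lower (n + 1)) = Lower (n + 1)" "fold_point n (Lower (n + 2)) = Upper (n + 1)"
    by (simp_all add: fold_point_def)
  have "(`) (cap_point n (n + 1)) ` tl_id_diagram n = tl_id_diagram n"
    unfolding tl_id_diagram_def image_image
    by (rule image_cong) (auto simp: cap_point_def fold_point_def)
  moreover have "tl_id_diagram (n + 1) = insert {Upper (n + 1), Lower (n + 1)} (tl_id_diagram n)"
    by (simp add: tl_id_diagram_def atLeastAtMostSuc_conv)
  ultimately show ?thesis
    using fold by (simp add: insert_cap_eq insert_commute)
qed

text \<open>Building the identity up by cap insertions inherits planarity from the general result on
  insertion.\<close>

lemma tl_id_diagram_tl_diagrams: "tl_id_diagram n \<in> tl_diagrams n n"
proof (induction n)
  case 0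
  show ?case
    by (simp add: tl_id_diagram_def tl_diagrams_def tl_points_def partition_on_def noncrossing_def)
next
  case (Suc n)
  then show ?case
    using insert_cap_tl_diagrams[of "tl_id_diagram n" n "n + 1"] insert_cap_id_diagram[of n] by simp
qed

text \<open>The folded identity has its only cap at \<open>n + 1\<close>, with coefficient
  \<open>[n + 1] / [n + 1] = 1\<close>; this is what fixes the denominator of the recursion.\<close>

lemma lookup_jw_step_id:
  assumes f: "f \<in> TL n n"
  shows "Poly_Mapping.lookup (jw_step n f) (tl_id_diagram (n + 1)) = Poly_Mapping.lookup f (tl_id_diagram n)"
proof -
  let ?I = "innermost_cap_positions (fold_down n (tl_id_diagram (n + 1)))"
  have i: "1 \<le> n + 1" "n + 1 \<le> n + 1" by simp_all
  note id = tl_id_diagram_tl_diagrams[of n]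
  have fold: "fold_down n (tl_id_diagram (n + 1)) =
      insert {Lower (n + 1), Lower (n + 1 + 1)} ((`) (shift_point (n + 1)) ` tl_id_diagram n)"
    using fold_down_insert_cap[OF id i] unfolding insert_cap_id_diagram .
  have remove: "remove_cap (n + 1) (fold_down n (tl_id_diagram (n + 1))) = tl_id_diagram n"
    using remove_cap_insert_cap[OF id i] unfolding insert_cap_id_diagram .
  have "{Lower k, Lower (k + 1)} \<notin> (`) (shift_point (n + 1)) ` tl_id_diagram n" for k
    by (auto simp: tl_id_diagram_def doubleton_eq_iff)
  then have "?I = {n + 1}"
    unfolding innermost_cap_positions_def fold by (auto simp: doubleton_eq_iff)
  moreover have "tl_id_diagram (n + 1) \<in> tl_diagrams (n + 1) (n + 1)"
    by (rule tl_id_diagram_tl_diagrams)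
  ultimately show ?thesis
    using lookup_jw_step[OF f] remove qint_nonzero[of "n + 1"] by simp
qed

text \<open>\<open>P\<close> collects the properties that identify an element as the idempotent. The
  step operator preserves \<open>P\<close>, so existence for all \<open>n\<close> and the recursion
  come out of one induction, each time identifying the constructed element by uniqueness.\<close>

lemma jones_wenzl_properties:
  "jones_wenzl n \<in> TL n n" "k \<in> {1..<n} \<Longrightarrow> jones_wenzl n \<circledast> tl_gen n k = 0"
  "Poly_Mapping.lookup (jones_wenzl n) (tl_id_diagram n) = 1"
  "jones_wenzl (Suc n) = jw_step n (jones_wenzl n)"
proof -
  define P where "P n f \<longleftrightarrow> f \<in> TL n n \<and> (\<forall>k\<in>{1..<n}. f \<circledast> tl_gen n k = 0) \<and>
    Poly_Mapping.lookup f (tl_id_diagram n) = 1" for n f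
  have P_eq: "jones_wenzl n = f" if "P n f" for n f
    using that unfolding P_def by (intro jones_wenzl_eqI) blast+
  have P_step: "P (Suc n) (jw_step n f)" if "P n f" for n f
    unfolding P_def
  proof (intro conjI ballI)
    show "jw_step n f \<in> TL (Suc n) (Suc n)"
      using that jw_step_TL[of f n] by (simp add: P_def)
    show "jw_step n f \<circledast> tl_gen (Suc n) k = 0" if "k \<in> {1..<Suc n}" for k
      using that \<open>P n f\<close> jw_step_gen_eq_0[of f n k] by (simp add: P_def)
    show "Poly_Mapping.lookup (jw_step n f) (tl_id_diagram (Suc n)) = 1"
      using that lookup_jw_step_id[of f n] by (simp add: P_def)
  qed
  have P_jw: "P n (jones_wenzl n)" for n
  proof (induction n)
    case 0
    \<comment> \<open>With no strands there are no generators, and the empty diagram is the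
      unit.\<close>
    have "P 0 (Poly_Mapping.single (tl_id_diagram 0) 1)"
      using tl_id_diagram_tl_diagrams[of 0] by (simp add: P_def TL_def)
    then show ?case
      using P_eq by metis
  next
    case (Suc n)
    from P_step[OF this] show ?case
      using P_eq by metis
  qed
  show "jones_wenzl n \<in> TL n n" "k \<in> {1..<n} \<Longrightarrow> jones_wenzl n \<circledast> tl_gen n k = 0"
    "Poly_Mapping.lookup (jones_wenzl n) (tl_id_diagram n) = 1"
    using P_jw[of n] by (simp_all add: P_def)
  show "jones_wenzl (Suc n) = jw_step n (jones_wenzl n)"
    using P_jw by (intro P_eq P_step)
qed

theorem proposition4p1:
  fixes n :: nat and D :: diagram
  assumes "n \<ge> 1"
    and "D \<in> tl_diagrams (n + 1) (n + 1)"
  shows "jw_coeff (n + 1) D =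
    (\<Sum>i\<in>innermost_cap_positions (fold_down n D).
       qint i / qint (n + 1) * jw_coeff n (remove_cap i (fold_down n D)))"
  using lookup_jw_step[OF jones_wenzl_properties(1) assms(2)]
  by (simp add: jw_coeff_def jones_wenzl_properties(4))

end
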